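(* Let $K$ be a field and $R_n=K[x_1,\dots,x_{n-1}]/(x_1,\dots,x_{n-1})^2$. Then for all (commutative) $K$-algebras $A$ of dimension $n$ over $K$, we have $$\dim_K G(A/K)\le \dim_K G(R_n/K).$$
   Context: All rings are commutative with unity. Note that $R_n$ has dimension $n$ over $K$. Let $A$ be a $K$-algebra of dimension $n$. For $a\in A$ let $P_a(x)=x^n-s_1(a)x^{n-1}+s_2(a)x^{n-2}-\cdots+(-1)^n s_n(a)$ be the characteristic polynomial of the $K$-linear map $A\to A$ given by multiplication by $a$; this defines $s_j(a)\in K$ for $1\le j\le n$. All tensor powers are over $K$. For $a\in A$ and $1\le i\le n$ let $a^{(i)}=1\otimes\cdots\otimes a\otimes\cdots\otimes 1\in A^{\otimes n}$, with $a$ in the $i$-th tensor factor. Let $I(A,K)\subset A^{\otimes n}$ be the ideal generated by all elements $$s_j(a)-\sum_{1\le i_1<\cdots<i_j\le n}a^{(i_1)}a^{(i_2)}\cdots a^{(i_j)},\qquad a\in A,\ 1\le j\le n.$$ The $S_n$-closure of $A$ over $K$ is the $K$-algebra $G(A/K)=A^{\otimes n}/I(A,K)$. *)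

theory Defs
  imports
    "Jordan_Normal_Form.VS_Connect"
    "Jordan_Normal_Form.Char_Poly"
    "HOL-Algebra.QuotRing"
    "HOL-Algebra.Ideal_Product"
    "HOL-Library.Poly_Mapping"
begin

text \<open>The base field is a type \<open>'k\<close> of class \<open>field\<close>, seen as a ring record through
  \<^const>\<open>class_ring\<close>; a commutative \<open>'k\<close>-algebra is a record \<open>A\<close> with
  \<open>algebra class_ring A\<close>. As \<^const>\<open>vectorspace.dim\<close> is unspecified on spaces that are not finitely
  generated, statements about it are accompanied by \<^const>\<open>vectorspace.fin_dim\<close>.\<close>

text \<open>The ring quotient with the induced scalar multiplication \<open>c \<odot> (I + x) = I + c \<odot> x\<close>.\<close>

definition quot_algebra :: "('k, 'a) module \<Rightarrow> 'a set \<Rightarrow> ('k, 'a set) module" where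
  "quot_algebra A I =
     ring.extend (A Quot I) (module.fields (\<lambda>c X. \<Union>x\<in>X. I +>\<^bsub>A\<^esub> (c \<odot>\<^bsub>A\<^esub> x)))"


subsection \<open>Characteristic polynomials of elements\<close>

text \<open>The choice operator selects the characteristic polynomial of the matrix of multiplication by
  \<open>a\<close> with respect to some ordered basis; by similarity it does not depend on that basis.\<close>

definition mult_char_poly :: "('k::field, 'a) module \<Rightarrow> 'a \<Rightarrow> 'k poly" where
  "mult_char_poly A a =
     (SOME p. \<exists>bs M. distinct bs \<and> vectorspace.basis class_ring A (set bs) \<and>
        M \<in> carrier_mat (length bs) (length bs) \<and>
        (\<forall>j<length bs. a \<otimes>\<^bsub>A\<^esub> bs ! j = (\<Oplus>\<^bsub>A\<^esub>i\<in>{..<length bs}. M $$ (i, j) \<odot>\<^bsub>A\<^esub> bs ! i)) \<and>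
        p = char_poly M)"

definition char_coeff :: "('k::field, 'a) module \<Rightarrow> nat \<Rightarrow> 'a \<Rightarrow> 'k" where
  "char_coeff A j a =
     (- 1) ^ j * poly.coeff (mult_char_poly A a) (vectorspace.dim class_ring A - j)"


subsection \<open>Tensor powers\<close>

text \<open>The algebra \<open>A\<^sup>\<otimes>\<^sup>n\<close> is the quotient of the free vector space on \<open>n\<close>-tuples of elements of \<open>A\<close>,
  with the product extending componentwise multiplication of tuples bilinearly, by the
  multilinearity relations. The product of a tuple with such a relation is again such a relation,
  so that the ideal they generate is also their linear span.\<close>

definition tuples :: "('k, 'a) module \<Rightarrow> nat \<Rightarrow> 'a list set" where
  "tuples A n = {u. length u = n \<and> set u \<subseteq> carrier A}"

definition tuple_algebra ::
    "('k::field, 'a) module \<Rightarrow> nat \<Rightarrow> ('k, 'a list \<Rightarrow>\<^sub>0 'k) module" where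
  "tuple_algebra A n =
     \<lparr>carrier = {p. Poly_Mapping.keys p \<subseteq> tuples A n},
      monoid.mult = (\<lambda>p q. \<Sum>u\<in>Poly_Mapping.keys p. \<Sum>v\<in>Poly_Mapping.keys q.
                Poly_Mapping.single (map2 (\<lambda>x y. x \<otimes>\<^bsub>A\<^esub> y) u v)
                  (Poly_Mapping.lookup p u * Poly_Mapping.lookup q v)),
      monoid.one = Poly_Mapping.single (replicate n \<one>\<^bsub>A\<^esub>) 1,
      ring.zero = 0,
      ring.add = (+),
      module.smult = (\<lambda>c. Poly_Mapping.map ((*) c))\<rparr>"

definition multilinear_relations ::
    "('k::field, 'a) module \<Rightarrow> nat \<Rightarrow> ('a list \<Rightarrow>\<^sub>0 'k) set" where
  "multilinear_relations A n =
     {Poly_Mapping.single (u[i := x \<oplus>\<^bsub>A\<^esub> y]) 1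
        - Poly_Mapping.single (u[i := x]) 1 - Poly_Mapping.single (u[i := y]) 1 | u i x y.
        u \<in> tuples A n \<and> i < n \<and> x \<in> carrier A \<and> y \<in> carrier A} \<union>
     {Poly_Mapping.single (u[i := c \<odot>\<^bsub>A\<^esub> x]) 1 - Poly_Mapping.single (u[i := x]) c | u i c x.
        u \<in> tuples A n \<and> i < n \<and> x \<in> carrier A}"

definition multilinear_ideal ::
    "('k::field, 'a) module \<Rightarrow> nat \<Rightarrow> ('a list \<Rightarrow>\<^sub>0 'k) set" where
  "multilinear_ideal A n = Idl\<^bsub>tuple_algebra A n\<^esub> (multilinear_relations A n)"

definition tensor_power ::
    "('k::field, 'a) module \<Rightarrow> nat \<Rightarrow> ('k, ('a list \<Rightarrow>\<^sub>0 'k) set) module" where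
  "tensor_power A n = quot_algebra (tuple_algebra A n) (multilinear_ideal A n)"

definition pure_tensor ::
    "('k::field, 'a) module \<Rightarrow> 'a list \<Rightarrow> ('a list \<Rightarrow>\<^sub>0 'k) set" where
  "pure_tensor A u =
     multilinear_ideal A (length u) +>\<^bsub>tuple_algebra A (length u)\<^esub> Poly_Mapping.single u 1"

text \<open>The tensor factors are numbered from \<open>0\<close> to \<open>n - 1\<close>.\<close>

definition in_factor ::
    "('k::field, 'a) module \<Rightarrow> nat \<Rightarrow> nat \<Rightarrow> 'a \<Rightarrow> ('a list \<Rightarrow>\<^sub>0 'k) set" where
  "in_factor A n i a = pure_tensor A ((replicate n \<one>\<^bsub>A\<^esub>)[i := a])"


subsection \<open>The \<open>S\<^sub>n\<close>-closure\<close>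

definition Sn_closure_ideal :: "('k::field, 'a) module \<Rightarrow> ('a list \<Rightarrow>\<^sub>0 'k) set set" where
  "Sn_closure_ideal A =
     (let n = vectorspace.dim class_ring A; T = tensor_power A n in
      Idl\<^bsub>T\<^esub> {(char_coeff A j a \<odot>\<^bsub>T\<^esub> \<one>\<^bsub>T\<^esub>)
               \<ominus>\<^bsub>T\<^esub> (\<Oplus>\<^bsub>T\<^esub>S\<in>{S. S \<subseteq> {..<n} \<and> card S = j}. \<Otimes>\<^bsub>T\<^esub>i\<in>S. in_factor A n i a)
             | a j. a \<in> carrier A \<and> 1 \<le> j \<and> j \<le> n})"

definition Sn_closure ::
    "('k::field, 'a) module \<Rightarrow> ('k, ('a list \<Rightarrow>\<^sub>0 'k) set set) module" where
  "Sn_closure A =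
     quot_algebra (tensor_power A (vectorspace.dim class_ring A)) (Sn_closure_ideal A)"


subsection \<open>The algebra \<open>K[x\<^sub>1, \<dots>, x\<^sub>n\<^sub>-\<^sub>1] / (x\<^sub>1, \<dots>, x\<^sub>n\<^sub>-\<^sub>1)\<^sup>2\<close>\<close>

text \<open>Monomials are exponent functions \<open>nat \<Rightarrow>\<^sub>0 nat\<close>; the variables allowed are \<open>x\<^sub>i\<close> with
  \<open>1 \<le> i < n\<close>.\<close>

definition polynomial_algebra :: "nat \<Rightarrow> ('k::field, (nat \<Rightarrow>\<^sub>0 nat) \<Rightarrow>\<^sub>0 'k) module" where
  "polynomial_algebra n =
     \<lparr>carrier = {p. \<forall>m\<in>Poly_Mapping.keys p. Poly_Mapping.keys m \<subseteq> {1..<n}},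
      monoid.mult = (*), monoid.one = 1, ring.zero = 0, ring.add = (+),
      module.smult = (\<lambda>c. Poly_Mapping.map ((*) c))\<rparr>"

definition variable_ideal :: "nat \<Rightarrow> ((nat \<Rightarrow>\<^sub>0 nat) \<Rightarrow>\<^sub>0 'k::field) set" where
  "variable_ideal n =
     Idl\<^bsub>polynomial_algebra n\<^esub>
       ((\<lambda>i. Poly_Mapping.single (Poly_Mapping.single i 1) 1) ` {1..<n})"

definition R_alg :: "nat \<Rightarrow> ('k::field, ((nat \<Rightarrow>\<^sub>0 nat) \<Rightarrow>\<^sub>0 'k) set) module" where
  "R_alg n =
     quot_algebra (polynomial_algebra n)
       (ideal_prod (polynomial_algebra n) (variable_ideal n) (variable_ideal n))"

end

theory Submission
  imports Defs
begin

text \<open>The algebra \<open>A\<close> degenerates to \<open>R\<^sub>n\<close>. Choose a basis \<open>b\<^sub>0 = 1, b\<^sub>1, \<dots>, b\<^sub>n\<^sub>-\<^sub>1\<close> of \<open>A\<close>, give \<open>b\<^sub>0\<close>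
degree \<open>0\<close> and every other \<open>b\<^sub>k\<close> degree \<open>1\<close>. A product of two basis elements of degree \<open>1\<close> has degree
at most \<open>1\<close>, which is less than the expected \<open>2\<close>; so in the associated graded algebra such products
vanish, and that graded algebra is \<open>R\<^sub>n\<close>. On \<open>A\<^sup>\<otimes>\<^sup>n\<close> a monomial \<open>b\<^bsub>f 0\<^esub> \<otimes> \<dots> \<otimes> b\<^bsub>f (n - 1)\<^esub>\<close> gets as degree
the number of factors different from \<open>1\<close>. If every homogeneous component of an element of \<open>I(R\<^sub>n, K)\<close>
is the leading form of an element of \<open>I(A, K)\<close>, then \<open>G(R\<^sub>n/K)\<close> maps
onto the graded space of \<open>G(A/K)\<close> and the inequality follows.

It is enough to see this for the generators. Write \<open>r \<in> R\<^sub>n\<close> as \<open>r = c + m\<close> with \<open>c \<in> K\<close> and \<open>m\<close> in the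
maximal ideal. As \<open>(r - c)\<^sup>2 = 0\<close>, the characteristic polynomial of \<open>r\<close> is \<open>(x - c)\<^sup>n\<close>
(\<open>mult_char_poly_square_zero_shift\<close>) and \<open>s\<^sub>j(r)\<close> is \<open>c\<^sup>j\<close> times a binomial coefficient. Hence the
component of degree \<open>0\<close> of the generator of index \<open>j\<close> vanishes, and the component of degree
\<open>d \<ge> 1\<close> is a multiple of the elementary symmetric expression \<open>e\<^sub>d(m)\<close> in the elements \<open>m\<^sup>(\<^sup>i\<^sup>)\<close>
(\<open>\<phi>_closure_relation\<close>). On the side of \<open>A\<close>, take the element \<open>m'\<close> with the same coordinates as \<open>m\<close>. Its
generator of index \<open>d\<close> says that \<open>e\<^sub>d(m')\<close> equals the scalar \<open>s\<^sub>d(m')\<close> modulo \<open>I(A, K)\<close>, and whatever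
that scalar is, it has degree \<open>0 < d\<close> (\<open>elementary_in_lower\<close>).

The graded space itself need not be constructed. Both \<open>G(A/K)\<close> and \<open>G(R\<^sub>n/K)\<close> are quotients of the algebra of
formal combinations of \<open>n\<close>-tuples by an ideal \<open>J\<close>, which is generated by multilinearity and the
closure relations (\<open>J_minimal\<close>). A linear map \<open>\<phi> d\<close> replaces the monomials of degree \<open>d\<close> of
\<open>R\<^sub>n\<^sup>\<otimes>\<^sup>n\<close> by those of \<open>A\<^sup>\<otimes>\<^sup>n\<close> and kills the others; the elements which every \<open>\<phi> d\<close> maps to elements of
degree below \<open>d\<close> modulo \<open>J\<close> form an ideal \<open>L\<close>, and by the above \<open>L\<close> contains \<open>J\<close>. Now choose monomials
whose classes form a basis of \<open>G(R\<^sub>n/K)\<close>. Induction on the degree shows that the corresponding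
monomials span \<open>G(A/K)\<close> (\<open>monspan_transfer\<close>).\<close>

section \<open>Surjections of algebras and quotient algebras\<close>

text \<open>Only operations on the image are constrained, so that the axioms of the codomain are consequences:
this is how the quotients below are shown to be algebras. The equation for \<open>\<zero>\<close> is an assumption
because before that proof it does not follow from additivity.\<close>

locale algebra_epi = algebra K A
  for K :: "('k, 'r) ring_scheme" (structure) and A :: "('k, 'a, 'm) module_scheme" (structure) +
  fixes B :: "('k, 'b, 'n) module_scheme" and h :: "'a \<Rightarrow> 'b"
  assumes surj: "h ` carrier A = carrier B"
    and h_add: "\<lbrakk>x \<in> carrier A; y \<in> carrier A\<rbrakk> \<Longrightarrow> h (x \<oplus>\<^bsub>A\<^esub> y) = h x \<oplus>\<^bsub>B\<^esub> h y"
    and h_mult: "\<lbrakk>x \<in> carrier A; y \<in> carrier A\<rbrakk> \<Longrightarrow> h (x \<otimes>\<^bsub>A\<^esub> y) = h x \<otimes>\<^bsub>B\<^esub> h y"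
    and h_one: "h \<one>\<^bsub>A\<^esub> = \<one>\<^bsub>B\<^esub>"
    and h_zero: "h \<zero>\<^bsub>A\<^esub> = \<zero>\<^bsub>B\<^esub>"
    and h_smult: "\<lbrakk>c \<in> carrier K; x \<in> carrier A\<rbrakk> \<Longrightarrow> h (c \<odot>\<^bsub>A\<^esub> x) = c \<odot>\<^bsub>B\<^esub> h x"
begin

lemma h_closed: "x \<in> carrier A \<Longrightarrow> h x \<in> carrier B"
  using surj by blast

lemma preimage:
  assumes "y \<in> carrier B"
  obtains x where "x \<in> carrier A" "y = h x"
  using assms surj by blast

lemma codomain_cring: "cring B"
proof (rule cringI)
  show "abelian_group B"
  proof (rule abelian_groupI)
    fix x assume "x \<in> carrier B"
    then obtain x' where x': "x' \<in> carrier A" "x = h x'" by (rule preimage)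
    show "\<exists>y\<in>carrier B. y \<oplus>\<^bsub>B\<^esub> x = \<zero>\<^bsub>B\<^esub>"
      using x' by (intro bexI[of _ "h (\<ominus>\<^bsub>A\<^esub> x')"])
        (simp_all add: h_closed h_add[symmetric] h_zero[symmetric] M.l_neg)
  qed (auto elim!: preimage simp: h_closed h_add[symmetric] h_zero[symmetric] M.a_ac)
  show "comm_monoid B"
    by (rule comm_monoidI)
      (auto elim!: preimage simp: h_closed h_mult[symmetric] h_one[symmetric] m_ac)
qed (auto elim!: preimage simp: h_closed h_mult[symmetric] h_add[symmetric] l_distr)

lemma codomain_algebra: "algebra K B"
proof (rule algebraI)
  show "cring K" by (rule R_cring)
  show "cring B" by (rule codomain_cring)
qed (auto elim!: preimage simp: h_closed h_mult[symmetric] h_add[symmetric] h_smult[symmetric]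
      smult_l_distr smult_r_distr smult_assoc1 smult_assoc2)

sublocale cod: algebra K B
  by (rule codomain_algebra)

sublocale hom: ring_hom_cring A B h
proof (unfold ring_hom_cring_def ring_hom_cring_axioms_def, intro conjI)
  show "cring A" by (rule M_cring)
  show "cring B" by (rule codomain_cring)
  show "h \<in> Ring.ring_hom A B"
    by (rule ring_hom_memI) (simp_all add: h_closed h_mult h_add h_one)
qed

lemma h_minus:
  "\<lbrakk>x \<in> carrier A; y \<in> carrier A\<rbrakk> \<Longrightarrow> h (x \<ominus>\<^bsub>A\<^esub> y) = h x \<ominus>\<^bsub>B\<^esub> h y"
  by (simp add: a_minus_def)

lemma image_ideal:
  assumes "ideal L A"
  shows "ideal (h ` L) B"
proof -
  interpret L: ideal L A by fact
  have sub: "L \<subseteq> carrier A" by (rule L.a_subset)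
  show ?thesis
  proof (rule idealI)
    show "ring B" by (rule cring.axioms(1)[OF codomain_cring])
    show "subgroup (h ` L) (add_monoid B)"
    proof (rule group.subgroupI)
      show "group (add_monoid B)" 
        by (rule abelian_group.a_group[OF ring.axioms(1)[OF cring.axioms(1)[OF codomain_cring]]])
      show "h ` L \<subseteq> carrier (add_monoid B)" using sub h_closed by auto
      show "h ` L \<noteq> {}" using L.zero_closed by blast
    next
      fix y assume "y \<in> h ` L"
      then obtain x where x: "x \<in> L" "y = h x" by blast
      have "\<ominus>\<^bsub>B\<^esub> y = h (\<ominus>\<^bsub>A\<^esub> x)" using x sub by (simp add: subsetD)
      then show "inv\<^bsub>add_monoid B\<^esub> y \<in> h ` L"
        using imageI[OF L.a_inv_closed[OF x(1)], of h] by (simp only: a_inv_def)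
    next
      fix y z assume "y \<in> h ` L" "z \<in> h ` L"
      then obtain x x' where "x \<in> L" "y = h x" "x' \<in> L" "z = h x'" by blast
      then have "y \<oplus>\<^bsub>B\<^esub> z = h (x \<oplus>\<^bsub>A\<^esub> x')" "x \<oplus>\<^bsub>A\<^esub> x' \<in> L"
        using sub by (auto simp: h_add L.a_closed)
      then show "y \<otimes>\<^bsub>add_monoid B\<^esub> z \<in> h ` L" by simp
    qed
  next
    fix y z assume "y \<in> h ` L" "z \<in> carrier B"
    then obtain x x' where x: "x \<in> L" "y = h x" "x' \<in> carrier A" "z = h x'"
      by (auto elim!: preimage)
    have "z \<otimes>\<^bsub>B\<^esub> y = h (x' \<otimes>\<^bsub>A\<^esub> x)" "y \<otimes>\<^bsub>B\<^esub> z = h (x \<otimes>\<^bsub>A\<^esub> x')"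
      using x sub by (auto simp: h_mult)
    then show "z \<otimes>\<^bsub>B\<^esub> y \<in> h ` L" "y \<otimes>\<^bsub>B\<^esub> z \<in> h ` L"
      using imageI[OF L.I_l_closed[OF x(1,3)], of h] imageI[OF L.I_r_closed[OF x(1,3)], of h]
      by (simp_all only:)
  qed
qed

lemma preimage_ideal:
  assumes "ideal L B"
  shows "ideal {x \<in> carrier A. h x \<in> L} A"
proof -
  have "ring_hom_ring A B h"
    by (rule ring_hom_ringI2) (simp_all add: cring.axioms(1)[OF codomain_cring] ring_axioms)
  then show ?thesis using assms by (rule ring_hom_ring.ideal_vimage)
qed

end

lemma algebra_epi_comp:
  assumes "algebra_epi K A B h" "algebra_epi K B C g"
  shows "algebra_epi K A C (\<lambda>x. g (h x))"
proof -
  interpret h: algebra_epi K A B h by fact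
  interpret g: algebra_epi K B C g by fact
  have "(\<lambda>x. g (h x)) ` carrier A = carrier C"
    using h.surj g.surj by (simp add: image_image[symmetric])
  then show ?thesis
    by (intro algebra_epi.intro algebra_epi_axioms.intro h.algebra_axioms)
      (simp_all only: h.h_closed h.h_add g.h_add h.h_mult g.h_mult h.h_one g.h_one
        h.h_zero g.h_zero h.h_smult g.h_smult)
qed

lemma quot_algebra_sel:
  "carrier (quot_algebra A I) = a_rcosets\<^bsub>A\<^esub> I"
  "x \<otimes>\<^bsub>quot_algebra A I\<^esub> y = [mod I:] x \<Otimes>\<^bsub>A\<^esub> y"
  "\<one>\<^bsub>quot_algebra A I\<^esub> = I +>\<^bsub>A\<^esub> \<one>\<^bsub>A\<^esub>"
  "\<zero>\<^bsub>quot_algebra A I\<^esub> = I"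
  "x \<oplus>\<^bsub>quot_algebra A I\<^esub> y = x <+>\<^bsub>A\<^esub> y"
  "c \<odot>\<^bsub>quot_algebra A I\<^esub> X = (\<Union>x\<in>X. I +>\<^bsub>A\<^esub> (c \<odot>\<^bsub>A\<^esub> x))"
  by (simp_all add: quot_algebra_def FactRing_def ring.defs module.defs)

lemma (in algebra) ideal_smult_closed:
  assumes "ideal I M" "c \<in> carrier R" "x \<in> I"
  shows "c \<odot>\<^bsub>M\<^esub> x \<in> I"
proof -
  interpret I: ideal I M by fact
  have x: "x \<in> carrier M" using assms(3) I.a_subset by blast
  have "c \<odot>\<^bsub>M\<^esub> x = (c \<odot>\<^bsub>M\<^esub> \<one>\<^bsub>M\<^esub>) \<otimes>\<^bsub>M\<^esub> x"
    using assms(2) x by (simp add: smult_assoc2)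
  then show ?thesis using assms x by (simp add: I.I_l_closed)
qed

text \<open>The scalar multiplication of the quotient is a union over the coset; it is well defined because an
ideal is closed under scalars (\<open>c \<odot> x = (c \<odot> \<one>) \<otimes> x\<close>), so all members of the union coincide.\<close>

lemma quot_algebra_epi:
  fixes R :: "('k, 'r) ring_scheme" and M :: "('k, 'a) module"
  assumes "algebra R M" "ideal I M"
  shows "algebra_epi R M (quot_algebra M I) ((+>\<^bsub>M\<^esub>) I)"
proof -
  interpret algebra R M by fact
  interpret I: ideal I M by fact
  have smult: "I +>\<^bsub>M\<^esub> (c \<odot>\<^bsub>M\<^esub> x) = (\<Union>y\<in>I +>\<^bsub>M\<^esub> x. I +>\<^bsub>M\<^esub> (c \<odot>\<^bsub>M\<^esub> y))"
    if c: "c \<in> carrier R" and x: "x \<in> carrier M" for c x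
  proof -
    have "I +>\<^bsub>M\<^esub> (c \<odot>\<^bsub>M\<^esub> y) = I +>\<^bsub>M\<^esub> (c \<odot>\<^bsub>M\<^esub> x)" if y: "y \<in> I +>\<^bsub>M\<^esub> x" for y
    proof -
      obtain i where i: "i \<in> I" "y = i \<oplus>\<^bsub>M\<^esub> x"
        using y by (auto simp: a_r_coset_def')
      have iM: "i \<in> carrier M" using i I.a_subset by blast
      have "c \<odot>\<^bsub>M\<^esub> y = c \<odot>\<^bsub>M\<^esub> i \<oplus>\<^bsub>M\<^esub> c \<odot>\<^bsub>M\<^esub> x"
        using i iM c x by (simp add: smult_r_distr)
      moreover have "c \<odot>\<^bsub>M\<^esub> i \<in> I" using assms(2) c i(1) by (rule ideal_smult_closed)
      ultimately have "c \<odot>\<^bsub>M\<^esub> y \<in> I +>\<^bsub>M\<^esub> (c \<odot>\<^bsub>M\<^esub> x)"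
        by (auto simp: a_r_coset_def')
      then show ?thesis
        by (rule a_repr_independence[OF _ _ I.a_subgroup, symmetric]) (use c x in simp)
    qed
    moreover have "I +>\<^bsub>M\<^esub> x \<noteq> {}" using I.a_rcos_self[OF x] by blast
    ultimately show ?thesis by (intro SUP_eq_const[symmetric])
  qed
  show ?thesis
  proof (intro algebra_epi.intro algebra_epi_axioms.intro algebra_axioms)
    show "(+>\<^bsub>M\<^esub>) I ` carrier M = carrier (quot_algebra M I)"
      unfolding quot_algebra_sel A_RCOSETS_def' by blast
  next
    fix c x assume "c \<in> carrier R" "x \<in> carrier M"
    then show "I +>\<^bsub>M\<^esub> (c \<odot>\<^bsub>M\<^esub> x) = c \<odot>\<^bsub>quot_algebra M I\<^esub> (I +>\<^bsub>M\<^esub> x)"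
      unfolding quot_algebra_sel(6) by (rule smult)
  qed (simp_all add: quot_algebra_sel I.a_rcos_sum I.rcoset_mult_add I.a_subset)
qed

lemma (in algebra) coset_eq_ideal_iff:
  assumes "ideal I M" "x \<in> carrier M"
  shows "I +>\<^bsub>M\<^esub> x = I \<longleftrightarrow> x \<in> I"
proof -
  interpret I: ideal I M by fact
  show ?thesis
    using I.a_rcos_self[OF assms(2)] I.a_rcos_const by metis
qed

section \<open>Finitely supported functions as a vector space\<close>

text \<open>The scalar multiplication of the records below, named so that it can instantiate the vector space
locale on the type of finitely supported functions; spans and subspaces are then available there
without carriers.\<close>

definition scale :: "'k::field \<Rightarrow> ('b \<Rightarrow>\<^sub>0 'k) \<Rightarrow> ('b \<Rightarrow>\<^sub>0 'k)" where
  "scale c = Poly_Mapping.map ((*) c)"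

lemma lookup_scale [simp]: "Poly_Mapping.lookup (scale c p) u = c * Poly_Mapping.lookup p u"
  by (simp add: scale_def Poly_Mapping.map.rep_eq when_def)

lemma scale_single [simp]:
  "scale c (Poly_Mapping.single u a) = Poly_Mapping.single u (c * a)"
  by (simp add: scale_def)

global_interpretation pm: Vector_Spaces.vector_space scale
  by unfold_locales (rule poly_mapping_eqI, simp add: lookup_add algebra_simps)+

lemma keys_scale: "Poly_Mapping.keys (scale c p) \<subseteq> Poly_Mapping.keys p"
  by (auto simp: in_keys_iff)

lemma keys_add_subset:
  "Poly_Mapping.keys p \<subseteq> S \<Longrightarrow> Poly_Mapping.keys q \<subseteq> S \<Longrightarrow> Poly_Mapping.keys (p + q) \<subseteq> S"
  using keys_add[of p q] by blast

lemma keys_scale_subset: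
  "Poly_Mapping.keys p \<subseteq> S \<Longrightarrow> Poly_Mapping.keys (scale c p) \<subseteq> S"
  using keys_scale[of c p] by blast

lemma keys_sum_subset:
  "(\<And>x. x \<in> S \<Longrightarrow> Poly_Mapping.keys (f x) \<subseteq> U) \<Longrightarrow> Poly_Mapping.keys (sum f S) \<subseteq> U"
  by (induction S rule: infinite_finite_induct) (simp_all add: keys_add_subset)

text \<open>The linear map that sends the basis vector at \<open>u\<close> to \<open>F u\<close>.\<close>

definition linext :: "('b \<Rightarrow> ('c \<Rightarrow>\<^sub>0 'k::field)) \<Rightarrow> ('b \<Rightarrow>\<^sub>0 'k) \<Rightarrow> ('c \<Rightarrow>\<^sub>0 'k)" where
  "linext F p = (\<Sum>u\<in>Poly_Mapping.keys p. scale (Poly_Mapping.lookup p u) (F u))"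

lemma linext_superset:
  assumes "finite S" "Poly_Mapping.keys p \<subseteq> S"
  shows "linext F p = (\<Sum>u\<in>S. scale (Poly_Mapping.lookup p u) (F u))"
  unfolding linext_def using assms
  by (intro sum.mono_neutral_left) (auto simp: in_keys_iff)

lemma linext_single [simp]: "linext F (Poly_Mapping.single u c) = scale c (F u)"
  by (simp add: linext_superset[of "{u}"])

lemma linext_add: "linext F (p + q) = linext F p + linext F q"
proof -
  let ?S = "Poly_Mapping.keys p \<union> Poly_Mapping.keys q"
  have "linext F r = (\<Sum>u\<in>?S. scale (Poly_Mapping.lookup r u) (F u))"
    if "r \<in> {p, q, p + q}" for r
    using that keys_add[of p q] by (intro linext_superset) auto
  then show ?thesis by (simp add: lookup_add pm.scale_left_distrib sum.distrib)
qed

lemma linext_scale: "linext F (scale c p) = scale c (linext F p)"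
  using keys_scale[of c p]
  by (simp add: linext_superset[of "Poly_Mapping.keys p"] pm.scale_sum_right)

global_interpretation linext: Vector_Spaces.linear scale scale "linext F" for F
  by unfold_locales (simp_all add: linext_add linext_scale)

lemma linext_add_fun: "linext (\<lambda>u. F u + G u) p = linext F p + linext G p"
  unfolding linext_def by (simp add: pm.scale_right_distrib sum.distrib)

lemma linext_scale_fun: "linext (\<lambda>u. scale c (F u)) p = scale c (linext F p)"
  unfolding linext_def by (simp add: pm.scale_sum_right mult.commute)

lemma poly_mapping_eq_sum_singles:
  fixes p :: "'b \<Rightarrow>\<^sub>0 'c::comm_monoid_add"
  shows "p = (\<Sum>u\<in>Poly_Mapping.keys p. Poly_Mapping.single u (Poly_Mapping.lookup p u))"
proof (rule poly_mapping_eqI)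
  fix k
  have "Poly_Mapping.lookup p k =
      (\<Sum>u\<in>Poly_Mapping.keys p. if u = k then Poly_Mapping.lookup p u else 0)"
    by (simp add: in_keys_iff)
  then show "Poly_Mapping.lookup p k = Poly_Mapping.lookup
      (\<Sum>u\<in>Poly_Mapping.keys p. Poly_Mapping.single u (Poly_Mapping.lookup p u)) k"
    by (simp add: lookup_sum lookup_single when_def)
qed

text \<open>Multilinear identities for finitely supported functions reduce to single basis vectors by this
induction, applied to one argument after the other.\<close>

lemma poly_mapping_span_induct [consumes 1, case_names zero single add]:
  fixes p :: "'b \<Rightarrow>\<^sub>0 'c::comm_monoid_add"
  assumes "Poly_Mapping.keys p \<subseteq> S"
    and "P 0"
    and "\<And>u c. u \<in> S \<Longrightarrow> P (Poly_Mapping.single u c)"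
    and "\<And>p q. P p \<Longrightarrow> P q \<Longrightarrow> P (p + q)"
  shows "P p"
proof -
  have "P (\<Sum>u\<in>U. Poly_Mapping.single u (Poly_Mapping.lookup p u))" if "U \<subseteq> S" for U
    using that by (induction U rule: infinite_finite_induct) (auto intro: assms(2-4))
  from this[OF assms(1)] show ?thesis
    using poly_mapping_eq_sum_singles[of p] by simp
qed

section \<open>The algebra of tuples\<close>

lemma finsum_eq_sum:
  assumes "abelian_monoid G" and "add G = (+)" "zero G = (0 :: 'b :: comm_monoid_add)"
    and "f \<in> S \<rightarrow> carrier G"
  shows "finsum G f S = sum f S"
proof -
  interpret abelian_monoid G by fact
  show ?thesis using assms(4)
    by (induction S rule: infinite_finite_induct) (simp_all add: assms(2,3) Pi_iff)
qed

text \<open>In a ring record built on a type with subtraction, the inverse operations of the record agree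
with those of the type.\<close>

lemma ideal_by_subtraction:
  fixes M :: "('b::ab_group_add, 'm) ring_scheme"
  assumes "cring M" and ops: "add M = (+)" "zero M = 0"
    and sub: "L \<subseteq> carrier M" and "0 \<in> L" and diff: "\<And>p q. p \<in> L \<Longrightarrow> q \<in> L \<Longrightarrow> p - q \<in> L"
    and mult: "\<And>p q. q \<in> carrier M \<Longrightarrow> p \<in> L \<Longrightarrow> q \<otimes>\<^bsub>M\<^esub> p \<in> L"
  shows "ideal L M"
proof -
  interpret cring M by fact
  have neg: "- p \<in> L" if "p \<in> L" for p using diff[OF \<open>0 \<in> L\<close> that] by simp
  show ?thesis
  proof (rule idealI)
    show "ring M" by (rule ring_axioms)
    show "subgroup L (add_monoid M)"
    proof (rule group.subgroupI)
      show "group (add_monoid M)" by (rule a_group)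
    next
      fix p assume p: "p \<in> L"
      then have "\<ominus>\<^bsub>M\<^esub> p = - p"
        using sub neg[OF p] by (intro minus_equality) (auto simp: ops)
      then show "inv\<^bsub>add_monoid M\<^esub> p \<in> L" using neg[OF p] by (simp only: a_inv_def)
    next
      fix p q assume "p \<in> L" "q \<in> L"
      then show "p \<otimes>\<^bsub>add_monoid M\<^esub> q \<in> L" using diff[of p "- q"] neg[of q] by (simp add: ops)
    qed (use sub \<open>0 \<in> L\<close> in auto)
  next
    fix p q assume p: "p \<in> L" and q: "q \<in> carrier M"
    then show "q \<otimes>\<^bsub>M\<^esub> p \<in> L" by (intro mult)
    then show "p \<otimes>\<^bsub>M\<^esub> q \<in> L" using m_comm[of p q] p q sub by auto
  qed
qed

lemma tuple_algebra_sel [simp]: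
  "carrier (tuple_algebra A n) = {p. Poly_Mapping.keys p \<subseteq> tuples A n}"
  "\<one>\<^bsub>tuple_algebra A n\<^esub> = Poly_Mapping.single (replicate n \<one>\<^bsub>A\<^esub>) 1"
  "\<zero>\<^bsub>tuple_algebra A n\<^esub> = 0"
  "add (tuple_algebra A n) = (+)"
  "module.smult (tuple_algebra A n) = scale"
  by (simp_all add: tuple_algebra_def scale_def fun_eq_iff)

abbreviation tuple_mult :: "('k::field, 'a) module \<Rightarrow> 'a list \<Rightarrow> 'a list \<Rightarrow> 'a list" where
  "tuple_mult A \<equiv> map2 (\<lambda>x y. x \<otimes>\<^bsub>A\<^esub> y)"

text \<open>In this form the multiplication is visibly bilinear, on arbitrary arguments and not just on the carrier.\<close>

lemma tuple_algebra_mult: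
  "p \<otimes>\<^bsub>tuple_algebra A n\<^esub> q =
    linext (\<lambda>u. linext (\<lambda>v. Poly_Mapping.single (tuple_mult A u v) 1) q) p"
  by (simp add: tuple_algebra_def linext_def pm.scale_sum_right)

lemma tuple_algebra_mult_single [simp]:
  "Poly_Mapping.single u a \<otimes>\<^bsub>tuple_algebra A n\<^esub> Poly_Mapping.single v b =
    Poly_Mapping.single (tuple_mult A u v) (a * b)"
  by (simp add: tuple_algebra_mult)

lemma tuple_algebra_mult_add:
  "(p + p') \<otimes>\<^bsub>tuple_algebra A n\<^esub> q = p \<otimes>\<^bsub>tuple_algebra A n\<^esub> q + p' \<otimes>\<^bsub>tuple_algebra A n\<^esub> q"
  "q \<otimes>\<^bsub>tuple_algebra A n\<^esub> (p + p') = q \<otimes>\<^bsub>tuple_algebra A n\<^esub> p + q \<otimes>\<^bsub>tuple_algebra A n\<^esub> p'"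
  by (simp_all add: tuple_algebra_mult linext_add linext_add_fun)

lemma tuple_algebra_mult_zero [simp]:
  "0 \<otimes>\<^bsub>tuple_algebra A n\<^esub> q = 0" "q \<otimes>\<^bsub>tuple_algebra A n\<^esub> 0 = 0"
  by (simp_all add: tuple_algebra_mult linext_def)

lemma tuple_algebra_mult_scale:
  "scale c p \<otimes>\<^bsub>tuple_algebra A n\<^esub> q = scale c (p \<otimes>\<^bsub>tuple_algebra A n\<^esub> q)"
  "q \<otimes>\<^bsub>tuple_algebra A n\<^esub> scale c p = scale c (q \<otimes>\<^bsub>tuple_algebra A n\<^esub> p)"
  by (simp_all add: tuple_algebra_mult linext_scale linext_scale_fun)

lemma tuple_algebra_mult_sum:
  "sum f S \<otimes>\<^bsub>tuple_algebra A n\<^esub> q = (\<Sum>x\<in>S. f x \<otimes>\<^bsub>tuple_algebra A n\<^esub> q)"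
  "q \<otimes>\<^bsub>tuple_algebra A n\<^esub> sum f S = (\<Sum>x\<in>S. q \<otimes>\<^bsub>tuple_algebra A n\<^esub> f x)"
  by (induction S rule: infinite_finite_induct) (simp_all add: tuple_algebra_mult_add)

lemma tuplesD: "u \<in> tuples A n \<Longrightarrow> length u = n" "u \<in> tuples A n \<Longrightarrow> i < n \<Longrightarrow> u ! i \<in> carrier A"
  by (auto simp: tuples_def)

lemma tuplesI: "length u = n \<Longrightarrow> (\<And>i. i < n \<Longrightarrow> u ! i \<in> carrier A) \<Longrightarrow> u \<in> tuples A n"
  by (auto simp: tuples_def set_conv_nth)

locale tuple_power = algebra class_ring A for A :: "('k::field, 'a) module" (structure) +
  fixes n :: nat
begin

abbreviation T where "T \<equiv> tuple_algebra A n"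

lemma tuple_mult_closed: "u \<in> tuples A n \<Longrightarrow> v \<in> tuples A n \<Longrightarrow> tuple_mult A u v \<in> tuples A n"
  by (auto intro!: tuplesI simp: tuplesD)

lemma tuple_algebra_closed:
  assumes "p \<in> carrier T" "q \<in> carrier T"
  shows "p \<otimes>\<^bsub>T\<^esub> q \<in> carrier T"
proof -
  have p: "Poly_Mapping.keys p \<subseteq> tuples A n" and q: "Poly_Mapping.keys q \<subseteq> tuples A n"
    using assms by simp_all
  have "Poly_Mapping.keys (p \<otimes>\<^bsub>T\<^esub> q) \<subseteq> tuples A n" using p
  proof (induction p rule: poly_mapping_span_induct)
    case (single u a)
    show ?case using q
    proof (induction q rule: poly_mapping_span_induct)
      case (single v b)
      then show ?case using \<open>u \<in> tuples A n\<close> by (simp add: tuple_mult_closed)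
    qed (simp_all add: tuple_algebra_mult_add keys_add_subset)
  qed (simp_all add: tuple_algebra_mult_add keys_add_subset)
  then show ?thesis by simp
qed

lemma tuple_algebra_one_closed: "replicate n \<one> \<in> tuples A n"
  by (auto intro: tuplesI)

lemma tuple_algebra_assoc:
  assumes "p \<in> carrier T" "q \<in> carrier T" "r \<in> carrier T"
  shows "(p \<otimes>\<^bsub>T\<^esub> q) \<otimes>\<^bsub>T\<^esub> r = p \<otimes>\<^bsub>T\<^esub> (q \<otimes>\<^bsub>T\<^esub> r)"
proof -
  have tuples_eq: "tuple_mult A (tuple_mult A u v) w = tuple_mult A u (tuple_mult A v w)"
    if "u \<in> tuples A n" "v \<in> tuples A n" "w \<in> tuples A n" for u v w
    using that by (intro nth_equalityI) (auto simp: tuplesD m_assoc)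
  have p: "Poly_Mapping.keys p \<subseteq> tuples A n" and q: "Poly_Mapping.keys q \<subseteq> tuples A n"
    and r: "Poly_Mapping.keys r \<subseteq> tuples A n" using assms by simp_all
  show ?thesis using p
  proof (induction p rule: poly_mapping_span_induct)
    case (single u a)
    show ?case using q
    proof (induction q rule: poly_mapping_span_induct)
      case (single v b)
      show ?case using r
      proof (induction r rule: poly_mapping_span_induct)
        case (single w c)
        then show ?case
          using \<open>u \<in> tuples A n\<close> \<open>v \<in> tuples A n\<close> by (simp add: tuples_eq mult.assoc)
      qed (simp_all add: tuple_algebra_mult_add)
    qed (simp_all add: tuple_algebra_mult_add)
  qed (simp_all add: tuple_algebra_mult_add)
qed

lemma tuple_algebra_comm:
  assumes "p \<in> carrier T" "q \<in> carrier T"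
  shows "p \<otimes>\<^bsub>T\<^esub> q = q \<otimes>\<^bsub>T\<^esub> p"
proof -
  have tuples_eq: "tuple_mult A u v = tuple_mult A v u"
    if "u \<in> tuples A n" "v \<in> tuples A n" for u v
    using that by (intro nth_equalityI) (auto simp: tuplesD m_comm)
  have p: "Poly_Mapping.keys p \<subseteq> tuples A n" and q: "Poly_Mapping.keys q \<subseteq> tuples A n"
    using assms by simp_all
  show ?thesis using p
  proof (induction p rule: poly_mapping_span_induct)
    case (single u a)
    show ?case using q
    proof (induction q rule: poly_mapping_span_induct)
      case (single v b)
      then show ?case
        using \<open>u \<in> tuples A n\<close> by (simp add: tuples_eq[of u v] mult.commute)
    qed (simp_all add: tuple_algebra_mult_add)
  qed (simp_all add: tuple_algebra_mult_add)
qed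

lemma tuple_algebra_one:
  assumes "p \<in> carrier T"
  shows "\<one>\<^bsub>T\<^esub> \<otimes>\<^bsub>T\<^esub> p = p"
proof -
  have p: "Poly_Mapping.keys p \<subseteq> tuples A n" using assms by simp
  then show ?thesis
  proof (induction p rule: poly_mapping_span_induct)
    case (single u a)
    then have "tuple_mult A (replicate n \<one>) u = u"
      by (intro nth_equalityI) (auto simp: tuplesD)
    then show ?case by simp
  qed (simp_all add: tuple_algebra_mult_add)
qed

sublocale T: algebra "class_ring :: 'k ring" T
proof (rule algebraI)
  show "cring (class_ring :: 'k ring)" by (rule R_cring)
  show "cring T"
  proof (rule cringI)
    show "abelian_group T"
    proof (rule abelian_groupI)
      fix p assume "p \<in> carrier T"
      then show "\<exists>q\<in>carrier T. q \<oplus>\<^bsub>T\<^esub> p = \<zero>\<^bsub>T\<^esub>" by (intro bexI[of _ "- p"]) auto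
    qed (simp_all add: keys_add_subset ac_simps)
    show "comm_monoid T"
    proof (rule comm_monoidI)
      show "\<one>\<^bsub>T\<^esub> \<in> carrier T" using tuple_algebra_one_closed by simp
      fix p q r assume "p \<in> carrier T" "q \<in> carrier T"
      then show "p \<otimes>\<^bsub>T\<^esub> q \<in> carrier T" "p \<otimes>\<^bsub>T\<^esub> q = q \<otimes>\<^bsub>T\<^esub> p"
        by (rule tuple_algebra_closed, rule tuple_algebra_comm)
      show "\<one>\<^bsub>T\<^esub> \<otimes>\<^bsub>T\<^esub> p = p" using \<open>p \<in> carrier T\<close> by (rule tuple_algebra_one)
      assume "r \<in> carrier T"
      with \<open>p \<in> carrier T\<close> \<open>q \<in> carrier T\<close>
      show "p \<otimes>\<^bsub>T\<^esub> q \<otimes>\<^bsub>T\<^esub> r = p \<otimes>\<^bsub>T\<^esub> (q \<otimes>\<^bsub>T\<^esub> r)"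
        by (rule tuple_algebra_assoc)
    qed
  qed (simp add: tuple_algebra_mult_add)
qed (simp_all add: keys_scale_subset tuple_algebra_mult_scale pm.scale_left_distrib
      pm.scale_right_distrib)

lemma T_minus:
  assumes "p \<in> carrier T" "q \<in> carrier T"
  shows "p \<ominus>\<^bsub>T\<^esub> q = p - q"
proof -
  have "\<ominus>\<^bsub>T\<^esub> q = - q" using assms by (intro T.M.minus_equality) auto
  then show ?thesis by (simp add: a_minus_def)
qed

lemma ideal_T_subspace:
  assumes "ideal L T"
  shows "pm.subspace L"
proof -
  interpret L: ideal L T by fact
  have "scale c p \<in> L" if "p \<in> L" for c p
    using T.ideal_smult_closed[OF assms, of c p] that by simp
  then show ?thesis
    using L.zero_closed L.a_closed by (auto simp: pm.subspace_def)
qed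

end

section \<open>The closure as a quotient of the algebra of tuples\<close>

context tuple_power
begin

lemma list_update_tuples: "u \<in> tuples A n \<Longrightarrow> x \<in> carrier A \<Longrightarrow> u[i := x] \<in> tuples A n"
  by (cases "i < n") (auto intro!: tuplesI simp: tuplesD nth_list_update)

lemma multilinear_relations_closed: "multilinear_relations A n \<subseteq> carrier T"
proof -
  have *: "Poly_Mapping.single u c \<in> carrier T" if "u \<in> tuples A n" for u and c :: 'k
    using that by simp
  have d: "p - q \<in> carrier T" if "p \<in> carrier T" "q \<in> carrier T" for p q
    using T.M.minus_closed[OF that] T_minus[OF that] by simp
  show ?thesis
    unfolding multilinear_relations_def
    by (auto simp del: tuple_algebra_sel intro!: d * list_update_tuples)
qed

abbreviation MI where "MI \<equiv> multilinear_ideal A n"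

lemma ideal_MI: "ideal MI T"
  unfolding multilinear_ideal_def
  by (rule T.genideal_ideal[OF multilinear_relations_closed])

sublocale tp: algebra_epi "class_ring :: 'k ring" T "tensor_power A n" "(+>\<^bsub>T\<^esub>) MI"
  unfolding tensor_power_def by (rule quot_algebra_epi[OF T.algebra_axioms ideal_MI])

text \<open>The tuple that represents the product of the elements \<open>a\<^sup>(\<^sup>i\<^sup>)\<close> for \<open>i \<in> S\<close>.\<close>

definition spread :: "nat set \<Rightarrow> 'a \<Rightarrow> 'a list" where
  "spread S a = map (\<lambda>i. if i \<in> S then a else \<one>) [0..<n]"

lemma spread_closed: "a \<in> carrier A \<Longrightarrow> spread S a \<in> tuples A n"
  by (auto intro!: tuplesI simp: spread_def)

lemma finprod_in_factor:
  assumes a: "a \<in> carrier A" and "S \<subseteq> {..<n}"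
  shows "(\<Otimes>\<^bsub>tensor_power A n\<^esub>i\<in>S. in_factor A n i a) =
    MI +>\<^bsub>T\<^esub> Poly_Mapping.single (spread S a) 1"
proof -
  have fact_eq: "in_factor A n i a = MI +>\<^bsub>T\<^esub> Poly_Mapping.single (spread {i} a) 1" if "i < n" for i
  proof -
    have "(replicate n \<one>)[i := a] = spread {i} a"
      using that by (intro nth_equalityI) (auto simp: spread_def nth_list_update)
    then show ?thesis by (simp add: in_factor_def pure_tensor_def spread_def)
  qed
  have closed: "Poly_Mapping.single (spread U a) (1::'k) \<in> carrier T" for U
    using spread_closed[OF a] by simp
  have "finite S" using assms(2) finite_subset by blast
  then show ?thesis using assms(2)
  proof (induction S)
    case empty
    have "spread {} a = replicate n \<one>" by (simp add: spread_def map_replicate_const)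
    then show ?case using tp.h_one by simp
  next
    case (insert i S)
    have "tuple_mult A (spread {i} a) (spread S a) = spread (insert i S) a"
      using insert a by (intro nth_equalityI) (auto simp: spread_def)
    then have "Poly_Mapping.single (spread (insert i S) a) 1 =
        Poly_Mapping.single (spread {i} a) (1::'k) \<otimes>\<^bsub>T\<^esub> Poly_Mapping.single (spread S a) 1"
      by simp
    moreover have "(\<lambda>i. in_factor A n i a) \<in> insert i S \<rightarrow> carrier (tensor_power A n)"
      using insert.prems fact_eq tp.h_closed[OF closed] by auto
    ultimately show ?case
      using insert fact_eq tp.h_mult[OF closed closed]
      by (subst tp.cod.finprod_insert) (simp_all add: Pi_iff)
  qed
qed

lemma multilinear_add_rel:
  assumes "u \<in> tuples A n" "i < n" "x \<in> carrier A" "y \<in> carrier A"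
  shows "Poly_Mapping.single (u[i := x \<oplus> y]) 1 - Poly_Mapping.single (u[i := x]) 1
    - Poly_Mapping.single (u[i := y]) 1 \<in> multilinear_relations A n"
  using assms unfolding multilinear_relations_def by blast

lemma multilinear_smult_rel:
  assumes "u \<in> tuples A n" "i < n" "x \<in> carrier A"
  shows "Poly_Mapping.single (u[i := c \<odot> x]) 1 - Poly_Mapping.single (u[i := x]) c
    \<in> multilinear_relations A n"
  using assms unfolding multilinear_relations_def by blast

end

locale closure_power = tuple_power A n
  for A :: "('k::field, 'a) module" (structure) and n +
  assumes dim_eq: "vectorspace.dim class_ring A = n"
begin

text \<open>The representative, among formal combinations of tuples, of the generator of index \<open>j\<close> of \<open>I(A, K)\<close>.\<close>

definition closure_relation :: "nat \<Rightarrow> 'a \<Rightarrow> ('a list \<Rightarrow>\<^sub>0 'k)" where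
  "closure_relation j a = Poly_Mapping.single (replicate n \<one>) (char_coeff A j a)
    - (\<Sum>S | S \<subseteq> {..<n} \<and> card S = j. Poly_Mapping.single (spread S a) 1)"

lemma closure_relation_closed:
  assumes "a \<in> carrier A" shows "closure_relation j a \<in> carrier T"
proof -
  have c: "Poly_Mapping.single (replicate n \<one>) (char_coeff A j a) \<in> carrier T"
    using tuple_algebra_one_closed by simp
  have s: "(\<Sum>S | S \<subseteq> {..<n} \<and> card S = j. Poly_Mapping.single (spread S a) (1::'k)) \<in> carrier T"
    using spread_closed[OF assms] by (simp add: keys_sum_subset)
  show ?thesis
    unfolding closure_relation_def T_minus[OF c s, symmetric] by (rule T.M.minus_closed[OF c s])
qed

lemma coset_closure_relation:
  assumes a: "a \<in> carrier A"
  shows "MI +>\<^bsub>T\<^esub> closure_relation j a =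
    (char_coeff A j a \<odot>\<^bsub>tensor_power A n\<^esub> \<one>\<^bsub>tensor_power A n\<^esub>) \<ominus>\<^bsub>tensor_power A n\<^esub>
      (\<Oplus>\<^bsub>tensor_power A n\<^esub>S\<in>{S. S \<subseteq> {..<n} \<and> card S = j}.
        \<Otimes>\<^bsub>tensor_power A n\<^esub>i\<in>S. in_factor A n i a)"
proof -
  let ?Ss = "{S. S \<subseteq> {..<n} \<and> card S = j}"
  let ?f = "\<lambda>S. Poly_Mapping.single (spread S a) (1::'k)"
  have f: "?f \<in> ?Ss \<rightarrow> carrier T" using spread_closed[OF a] by simp
  let ?c = "Poly_Mapping.single (replicate n \<one>) (char_coeff A j a)"
  have c: "?c \<in> carrier T" using tuple_algebra_one_closed by simp
  have "char_coeff A j a \<odot>\<^bsub>tensor_power A n\<^esub> \<one>\<^bsub>tensor_power A n\<^esub> = MI +>\<^bsub>T\<^esub> ?c"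
    using tp.h_smult[of "char_coeff A j a" "\<one>\<^bsub>T\<^esub>"] tp.h_one tuple_algebra_one_closed by simp
  moreover have "(\<Oplus>\<^bsub>tensor_power A n\<^esub>S\<in>?Ss. \<Otimes>\<^bsub>tensor_power A n\<^esub>i\<in>S. in_factor A n i a) =
      MI +>\<^bsub>T\<^esub> sum ?f ?Ss"
  proof -
    have "(\<Oplus>\<^bsub>tensor_power A n\<^esub>S\<in>?Ss. \<Otimes>\<^bsub>tensor_power A n\<^esub>i\<in>S. in_factor A n i a) =
        (\<Oplus>\<^bsub>tensor_power A n\<^esub>S\<in>?Ss. MI +>\<^bsub>T\<^esub> ?f S)"
    proof (rule tp.cod.finsum_cong')
      show "(\<lambda>S. MI +>\<^bsub>T\<^esub> ?f S) \<in> ?Ss \<rightarrow> carrier (tensor_power A n)"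
        using tp.h_closed Pi_mem[OF f] by blast
    qed (simp_all add: finprod_in_factor[OF a])
    also have "\<dots> = MI +>\<^bsub>T\<^esub> (\<Oplus>\<^bsub>T\<^esub>S\<in>?Ss. ?f S)"
      using tp.hom.hom_finsum[OF f] by (simp only: comp_def)
    also have "(\<Oplus>\<^bsub>T\<^esub>S\<in>?Ss. ?f S) = sum ?f ?Ss"
      by (rule finsum_eq_sum[OF _ _ _ f]) (simp_all add: T.M.abelian_monoid_axioms)
    finally show ?thesis .
  qed
  moreover have s: "sum ?f ?Ss \<in> carrier T"
    using spread_closed[OF a] by (simp add: keys_sum_subset)
  ultimately show ?thesis
    unfolding closure_relation_def T_minus[OF c s, symmetric] by (simp only: tp.h_minus[OF c s])
qed

lemma Sn_closure_ideal_eq: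
  "Sn_closure_ideal A = Idl\<^bsub>tensor_power A n\<^esub>
    {MI +>\<^bsub>T\<^esub> closure_relation j a | a j. a \<in> carrier A \<and> 1 \<le> j \<and> j \<le> n}"
  unfolding Sn_closure_ideal_def Let_def dim_eq
  by (intro arg_cong[where f = "genideal _"] Collect_cong ex_cong1) (auto simp: coset_closure_relation)

lemma closure_relations_closed:
  "{MI +>\<^bsub>T\<^esub> closure_relation j a | a j. a \<in> carrier A \<and> 1 \<le> j \<and> j \<le> n}
    \<subseteq> carrier (tensor_power A n)"
  using tp.h_closed[OF closure_relation_closed] by auto

lemma ideal_Sn_closure_ideal: "ideal (Sn_closure_ideal A) (tensor_power A n)"
  unfolding Sn_closure_ideal_eq by (rule tp.cod.genideal_ideal[OF closure_relations_closed])

definition proj :: "('a list \<Rightarrow>\<^sub>0 'k) \<Rightarrow> ('a list \<Rightarrow>\<^sub>0 'k) set set" where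
  "proj p = Sn_closure_ideal A +>\<^bsub>tensor_power A n\<^esub> (MI +>\<^bsub>T\<^esub> p)"

sublocale proj: algebra_epi "class_ring :: 'k ring" T "Sn_closure A" proj
  unfolding proj_def Sn_closure_def dim_eq
  by (rule algebra_epi_comp[OF tp.algebra_epi_axioms
        quot_algebra_epi[OF tp.codomain_algebra ideal_Sn_closure_ideal]])

text \<open>The closure arises by two successive quotients; \<open>J\<close> is the kernel of their composition.\<close>

definition J :: "('a list \<Rightarrow>\<^sub>0 'k) set" where
  "J = {p \<in> carrier T. MI +>\<^bsub>T\<^esub> p \<in> Sn_closure_ideal A}"

lemma ideal_J: "ideal J T"
  unfolding J_def by (rule tp.preimage_ideal[OF ideal_Sn_closure_ideal])

lemma proj_eq_zero_iff: "p \<in> carrier T \<Longrightarrow> proj p = \<zero>\<^bsub>Sn_closure A\<^esub> \<longleftrightarrow> p \<in> J"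
  using tp.cod.coset_eq_ideal_iff[OF ideal_Sn_closure_ideal tp.h_closed[of p]]
  by (simp add: proj_def Sn_closure_def quot_algebra_sel J_def dim_eq del: tuple_algebra_sel)

lemma MI_subset_J: "MI \<subseteq> J"
proof
  fix p assume p: "p \<in> MI"
  then have pT: "p \<in> carrier T" using ideal.Icarr[OF ideal_MI] by blast
  then have "MI +>\<^bsub>T\<^esub> p = \<zero>\<^bsub>tensor_power A n\<^esub>"
    using p T.coset_eq_ideal_iff[OF ideal_MI] by (simp add: tensor_power_def quot_algebra_sel)
  then show "p \<in> J"
    using pT additive_subgroup.zero_closed[OF ideal.axioms(1)[OF ideal_Sn_closure_ideal]]
    by (simp add: J_def del: tuple_algebra_sel)
qed

lemma relations_in_J: "multilinear_relations A n \<subseteq> J"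
  using T.genideal_self[OF multilinear_relations_closed] MI_subset_J
  unfolding multilinear_ideal_def by blast

lemma closure_relation_in_J:
  assumes "a \<in> carrier A" "1 \<le> j" "j \<le> n"
  shows "closure_relation j a \<in> J"
  using tp.cod.genideal_self[OF closure_relations_closed] closure_relation_closed assms
  unfolding J_def Sn_closure_ideal_eq by blast

text \<open>An ideal \<open>L\<close> that contains the relations contains the ideal of multilinearity, so it is the full
preimage of its image in the tensor power; and that image is an ideal containing the generators of \<open>I(A, K)\<close>.\<close>

lemma J_minimal:
  assumes L: "ideal L T" and rel: "multilinear_relations A n \<subseteq> L"
    and gen: "\<And>a j. a \<in> carrier A \<Longrightarrow> 1 \<le> j \<Longrightarrow> j \<le> n \<Longrightarrow> closure_relation j a \<in> L"
  shows "J \<subseteq> L"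
proof
  interpret L: ideal L T by fact
  interpret MI: ideal MI T by (rule ideal_MI)
  fix p assume "p \<in> J"
  then have p: "p \<in> carrier T" and "MI +>\<^bsub>T\<^esub> p \<in> Sn_closure_ideal A" by (simp_all add: J_def)
  moreover have "Sn_closure_ideal A \<subseteq> (+>\<^bsub>T\<^esub>) MI ` L"
    unfolding Sn_closure_ideal_eq
    by (rule tp.cod.genideal_minimal[OF tp.image_ideal[OF L]]) (use gen in blast)
  ultimately obtain q where q: "q \<in> L" "MI +>\<^bsub>T\<^esub> p = MI +>\<^bsub>T\<^esub> q" by blast
  have "MI \<subseteq> L" unfolding multilinear_ideal_def by (rule T.genideal_minimal[OF L rel])
  moreover have "p \<in> MI +>\<^bsub>T\<^esub> q"
    using MI.a_rcos_self[OF p] q(2) by simp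
  ultimately obtain m where "m \<in> L" "p = m + q" by (auto simp: a_r_coset_def')
  then show "p \<in> L" using q L.a_closed by fastforce
qed

end

section \<open>Monomials in a basis containing the unit\<close>

text \<open>Congruence modulo a subspace; the subspaces used are \<open>J\<close> and \<open>J\<close> enlarged by monomials.\<close>

definition eqmod :: "('b \<Rightarrow>\<^sub>0 'k::field) set \<Rightarrow> ('b \<Rightarrow>\<^sub>0 'k) \<Rightarrow> ('b \<Rightarrow>\<^sub>0 'k) \<Rightarrow> bool" where
  "eqmod W p q \<longleftrightarrow> p - q \<in> W"

lemma eqmod_refl: "pm.subspace W \<Longrightarrow> eqmod W p p"
  by (simp add: eqmod_def pm.subspace_0)

lemma eqmod_sym: "pm.subspace W \<Longrightarrow> eqmod W p q \<Longrightarrow> eqmod W q p"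
  unfolding eqmod_def using pm.subspace_neg by fastforce

lemma eqmod_trans: "pm.subspace W \<Longrightarrow> eqmod W p q \<Longrightarrow> eqmod W q r \<Longrightarrow> eqmod W p r"
  unfolding eqmod_def using pm.subspace_add[of W "p - q" "q - r"] by simp

lemma eqmod_add: "pm.subspace W \<Longrightarrow> eqmod W p q \<Longrightarrow> eqmod W p' q' \<Longrightarrow> eqmod W (p + p') (q + q')"
  unfolding eqmod_def using pm.subspace_add[of W "p - q" "p' - q'"] by (simp add: algebra_simps)

lemma eqmod_scale: "pm.subspace W \<Longrightarrow> eqmod W p q \<Longrightarrow> eqmod W (scale c p) (scale c q)"
  unfolding eqmod_def using pm.subspace_scale[of W "p - q" c] by (simp add: pm.scale_right_diff_distrib)

lemma eqmod_sum:
  "pm.subspace W \<Longrightarrow> (\<And>x. x \<in> S \<Longrightarrow> eqmod W (f x) (g x)) \<Longrightarrow> eqmod W (sum f S) (sum g S)"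
  unfolding eqmod_def sum_subtractf[symmetric] by (rule pm.subspace_sum)

lemma eqmod_mono: "eqmod W p q \<Longrightarrow> W \<subseteq> W' \<Longrightarrow> eqmod W' p q"
  unfolding eqmod_def by blast

lemma eqmod_mem: "pm.subspace W \<Longrightarrow> eqmod W p q \<Longrightarrow> q \<in> W \<Longrightarrow> p \<in> W"
  unfolding eqmod_def using pm.subspace_add[of W "p - q" q] by simp

text \<open>The elements \<open>b 0, \<dots>, b (n - 1)\<close> are a basis starting with the unit, but the assumptions record only
that they span: \<open>coord\<close> is some choice of coefficients.\<close>

locale monomial_power = closure_power A n
  for A :: "('k::field, 'a) module" (structure) and n +
  fixes b :: "nat \<Rightarrow> 'a" and coord :: "'a \<Rightarrow> nat \<Rightarrow> 'k"
  assumes n_pos: "0 < n"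
    and b_closed: "k < n \<Longrightarrow> b k \<in> carrier A"
    and b_0: "b 0 = \<one>"
    and coord: "a \<in> carrier A \<Longrightarrow> a = (\<Oplus>k\<in>{..<n}. coord a k \<odot> b k)"
begin

definition Idx :: "(nat \<Rightarrow> nat) set" where
  "Idx = {..<n} \<rightarrow>\<^sub>E {..<n}"

text \<open>The number of tensor factors different from the unit.\<close>

definition deg :: "(nat \<Rightarrow> nat) \<Rightarrow> nat" where
  "deg f = card {i. i < n \<and> f i \<noteq> 0}"

definition mon_tuple :: "(nat \<Rightarrow> nat) \<Rightarrow> 'a list" where
  "mon_tuple f = map (\<lambda>i. b (f i)) [0..<n]"

definition mon :: "(nat \<Rightarrow> nat) \<Rightarrow> ('a list \<Rightarrow>\<^sub>0 'k)" where
  "mon f = Poly_Mapping.single (mon_tuple f) 1"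

lemma finite_Idx: "finite Idx"
  by (simp add: Idx_def finite_PiE)

lemma Idx_less: "f \<in> Idx \<Longrightarrow> i < n \<Longrightarrow> f i < n"
  by (auto simp: Idx_def)

lemma mon_tuple_closed: "f \<in> Idx \<Longrightarrow> mon_tuple f \<in> tuples A n"
  by (auto intro!: tuplesI simp: mon_tuple_def b_closed Idx_less)

lemma mon_closed: "f \<in> Idx \<Longrightarrow> mon f \<in> carrier T"
  using mon_tuple_closed by (simp add: mon_def)

lemma subspace_J: "pm.subspace J"
  by (rule ideal_T_subspace[OF ideal_J])

lemma single_update_eqmod:
  assumes u: "u \<in> tuples A n" and i: "i < n" and "finite S" "x \<in> S \<rightarrow> carrier A"
  shows "eqmod J (Poly_Mapping.single (u[i := (\<Oplus>k\<in>S. d k \<odot> x k)]) 1)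
    (\<Sum>k\<in>S. Poly_Mapping.single (u[i := x k]) (d k))"
  using assms(3,4)
proof (induction S)
  case empty
  have "Poly_Mapping.single (u[i := 0 \<odot> \<zero>]) (1::'k) - Poly_Mapping.single (u[i := \<zero>]) 0 \<in> J"
    using multilinear_smult_rel[OF u i, of \<zero> 0] relations_in_J by blast
  then show ?case by (simp add: eqmod_def)
next
  case (insert k S)
  have closed: "x k \<in> carrier A" "(\<Oplus>k\<in>S. d k \<odot> x k) \<in> carrier A" "d k \<odot> x k \<in> carrier A"
    using insert.prems by (auto simp: Pi_iff intro!: M.finsum_closed)
  have "(\<Oplus>k\<in>insert k S. d k \<odot> x k) = d k \<odot> x k \<oplus> (\<Oplus>k\<in>S. d k \<odot> x k)"
    using insert by (intro M.finsum_insert) (auto simp: Pi_iff)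
  then have 1: "eqmod J (Poly_Mapping.single (u[i := (\<Oplus>k\<in>insert k S. d k \<odot> x k)]) 1)
      (Poly_Mapping.single (u[i := d k \<odot> x k]) 1 +
       Poly_Mapping.single (u[i := (\<Oplus>k\<in>S. d k \<odot> x k)]) 1)"
    using multilinear_add_rel[OF u i closed(3,2)] relations_in_J
    by (auto simp: eqmod_def algebra_simps)
  have 2: "eqmod J (Poly_Mapping.single (u[i := d k \<odot> x k]) 1) (Poly_Mapping.single (u[i := x k]) (d k))"
    using multilinear_smult_rel[OF u i closed(1)] relations_in_J by (auto simp: eqmod_def)
  have 3: "eqmod J (Poly_Mapping.single (u[i := (\<Oplus>k\<in>S. d k \<odot> x k)]) 1)
      (\<Sum>k\<in>S. Poly_Mapping.single (u[i := x k]) (d k))"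
    using insert by auto
  show ?case
    using eqmod_trans[OF subspace_J 1 eqmod_add[OF subspace_J 2 3]] insert.hyps by simp
qed

lemma sum_PiE_Suc:
  "(\<Sum>f\<in>{..<Suc k} \<rightarrow>\<^sub>E B. F f) = (\<Sum>f\<in>{..<k} \<rightarrow>\<^sub>E B. \<Sum>j\<in>B. F (f(k := j)))"
proof -
  have "{..<Suc k} \<rightarrow>\<^sub>E B = (\<lambda>(j, f). f(k := j)) ` (B \<times> ({..<k} \<rightarrow>\<^sub>E B))"
    by (simp add: lessThan_Suc PiE_insert_eq)
  moreover have "inj_on (\<lambda>(j, f). f(k := j)) (B \<times> ({..<k} \<rightarrow>\<^sub>E B))"
    using inj_combinator[of k "{..<k}" "\<lambda>_. B"] by simp
  ultimately have "(\<Sum>f\<in>{..<Suc k} \<rightarrow>\<^sub>E B. F f) = (\<Sum>(j, f)\<in>B \<times> ({..<k} \<rightarrow>\<^sub>E B). F (f(k := j)))"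
    by (simp only: sum.reindex comp_def case_prod_unfold)
  also have "\<dots> = (\<Sum>f\<in>{..<k} \<rightarrow>\<^sub>E B. \<Sum>j\<in>B. F (f(k := j)))"
    by (subst sum.cartesian_product[symmetric], rule sum.swap)
  finally show ?thesis .
qed

text \<open>Multilinear expansion of a pure tensor, by replacing one entry after the other: the auxiliary tuple
\<open>v k f\<close> has its first \<open>k\<close> entries already replaced by the basis elements that \<open>f\<close> selects.\<close>

lemma expand_tuple:
  assumes u: "u \<in> tuples A n"
    and c: "\<And>i. i < n \<Longrightarrow> u ! i = (\<Oplus>k\<in>{..<n}. c i k \<odot> b k)"
  shows "eqmod J (Poly_Mapping.single u 1) (\<Sum>f\<in>Idx. scale (\<Prod>i<n. c i (f i)) (mon f))"
proof -
  define v where "v k f = map (\<lambda>i. if i < k then b (f i) else u ! i) [0..<n]" for k f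
  have expand: "eqmod J (Poly_Mapping.single u 1)
      (\<Sum>f\<in>{..<k} \<rightarrow>\<^sub>E {..<n}. Poly_Mapping.single (v k f) (\<Prod>i<k. c i (f i)))" if "k \<le> n" for k
    using that
  proof (induction k)
    case 0
    have "v 0 f = u" for f
      using u by (intro nth_equalityI) (auto simp: v_def tuplesD)
    then show ?case by (simp add: eqmod_refl[OF subspace_J])
  next
    case (Suc k)
    have step: "eqmod J (Poly_Mapping.single (v k f) (\<Prod>i<k. c i (f i)))
        (\<Sum>j<n. Poly_Mapping.single (v (Suc k) (f(k := j))) (\<Prod>i<Suc k. c i ((f(k := j)) i)))"
      if f: "f \<in> {..<k} \<rightarrow>\<^sub>E {..<n}" for f
    proof -
      have "f i < n" if "i < k" for i using f that by auto
      then have vk: "v k f \<in> tuples A n"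
        using Suc.prems u by (auto intro!: tuplesI simp: v_def b_closed tuplesD)
      have "v k f = (v k f)[k := (\<Oplus>j\<in>{..<n}. c k j \<odot> b j)]"
        using Suc.prems c[of k] by (intro nth_equalityI) (auto simp: v_def nth_list_update)
      moreover have "v (Suc k) (f(k := j)) = (v k f)[k := b j]" for j
        using Suc.prems by (intro nth_equalityI) (auto simp: v_def nth_list_update)
      ultimately have "eqmod J (Poly_Mapping.single (v k f) 1)
          (\<Sum>j<n. Poly_Mapping.single (v (Suc k) (f(k := j))) (c k j))"
        using single_update_eqmod[OF vk, of k "{..<n}" b "c k"] Suc.prems b_closed by auto
      from eqmod_scale[OF subspace_J this, of "\<Prod>i<k. c i (f i)"]
      show ?thesis by (simp add: pm.scale_sum_right)
    qed
    have "eqmod J (Poly_Mapping.single u 1)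
      (\<Sum>f\<in>{..<k} \<rightarrow>\<^sub>E {..<n}. Poly_Mapping.single (v k f) (\<Prod>i<k. c i (f i)))"
      using Suc by simp
    from eqmod_trans[OF subspace_J this eqmod_sum[OF subspace_J step]]
    show ?case unfolding sum_PiE_Suc .
  qed
  have "v n f = mon_tuple f" for f by (simp add: v_def mon_tuple_def)
  then show ?thesis using expand[of n] by (simp add: Idx_def mon_def)
qed

text \<open>The preimage of the span of the classes of the given monomials in the closure.\<close>

definition monspan :: "(nat \<Rightarrow> nat) set \<Rightarrow> ('a list \<Rightarrow>\<^sub>0 'k) set" where
  "monspan C = pm.span (mon ` C \<union> J)"

lemma subspace_monspan: "pm.subspace (monspan C)"
  by (simp add: monspan_def pm.subspace_span)

lemma mon_in_monspan: "f \<in> C \<Longrightarrow> mon f \<in> monspan C"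
  by (simp add: monspan_def pm.span_base)

lemma J_subset_monspan: "J \<subseteq> monspan C"
  unfolding monspan_def using pm.span_superset by blast

lemma monspan_mono: "C \<subseteq> D \<Longrightarrow> monspan C \<subseteq> monspan D"
  unfolding monspan_def by (rule pm.span_mono) blast

lemma monspan_subset:
  assumes "\<And>f. f \<in> C \<Longrightarrow> mon f \<in> W" "J \<subseteq> W" "pm.subspace W"
  shows "monspan C \<subseteq> W"
  unfolding monspan_def using assms by (intro pm.span_minimal) auto

lemma monspan_Idx: "carrier T \<subseteq> monspan Idx"
proof
  fix p assume "p \<in> carrier T"
  then have "Poly_Mapping.keys p \<subseteq> tuples A n" by simp
  then show "p \<in> monspan Idx"
  proof (induction p rule: poly_mapping_span_induct)
    case zero
    show ?case by (rule pm.subspace_0[OF subspace_monspan])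
  next
    case (single u c)
    have "(\<Sum>f\<in>Idx. scale (\<Prod>i<n. coord (u ! i) (f i)) (mon f)) \<in> monspan Idx"
      by (intro pm.subspace_sum pm.subspace_scale subspace_monspan mon_in_monspan)
    moreover have "eqmod J (Poly_Mapping.single u 1)
        (\<Sum>f\<in>Idx. scale (\<Prod>i<n. coord (u ! i) (f i)) (mon f))"
      using single by (intro expand_tuple coord) (auto simp: tuplesD)
    ultimately have "Poly_Mapping.single u 1 \<in> monspan Idx"
      using eqmod_mem[OF subspace_monspan eqmod_mono[OF _ J_subset_monspan]] by blast
    then show ?case
      using pm.subspace_scale[OF subspace_monspan, of "Poly_Mapping.single u 1" Idx c] by simp
  next
    case (add p q)
    then show ?case by (rule pm.subspace_add[OF subspace_monspan])
  qed
qed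

text \<open>The filtration by degree, as a chain of subspaces containing \<open>J\<close>.\<close>

definition lower :: "nat \<Rightarrow> ('a list \<Rightarrow>\<^sub>0 'k) set" where
  "lower d = monspan {f \<in> Idx. deg f < d}"

lemma subspace_lower: "pm.subspace (lower d)"
  by (simp add: lower_def subspace_monspan)

lemma J_subset_lower: "J \<subseteq> lower d"
  by (simp add: lower_def J_subset_monspan)

lemma lower_mono: "d \<le> e \<Longrightarrow> lower d \<subseteq> lower e"
  unfolding lower_def by (rule monspan_mono) auto

lemma mon_in_lower: "f \<in> Idx \<Longrightarrow> deg f < d \<Longrightarrow> mon f \<in> lower d"
  unfolding lower_def by (rule mon_in_monspan) simp

end

text \<open>The structure constants of \<open>R\<^sub>n\<close> in the basis \<open>1, x\<^sub>1, \<dots>, x\<^sub>n\<^sub>-\<^sub>1\<close>: the product of the basis elements of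
indices \<open>i\<close> and \<open>j\<close> is the one of index \<open>i + j\<close> if one of the indices is \<open>0\<close>, and \<open>0\<close> otherwise.\<close>

definition join_coeff :: "nat \<Rightarrow> nat \<Rightarrow> nat \<Rightarrow> 'k::comm_ring_1" where
  "join_coeff i j k = (if (i = 0 \<or> j = 0) \<and> i + j = k then 1 else 0)"

context monomial_power
begin

text \<open>Up to lower degree, monomials of \<open>A\<^sup>\<otimes>\<^sup>n\<close> multiply as those of \<open>R\<^sub>n\<^sup>\<otimes>\<^sup>n\<close>. In a tensor factor where one of the two
entries is the unit, the structure constants of \<open>A\<close> are those of \<open>R\<^sub>n\<close>. A factor where neither is the
unit contributes at most \<open>1\<close> instead of \<open>2\<close> to the degree of the product.\<close>

lemma mon_mult:
  assumes g: "g \<in> Idx" and h: "h \<in> Idx"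
  shows "eqmod (lower (deg g + deg h)) (mon g \<otimes>\<^bsub>T\<^esub> mon h)
    (\<Sum>f | f \<in> Idx \<and> deg f = deg g + deg h. scale (\<Prod>i<n. join_coeff (g i) (h i) (f i)) (mon f))"
proof -
  let ?d = "deg g + deg h"
  define c where "c i k = (if g i = 0 \<or> h i = 0 then join_coeff (g i) (h i) k
    else coord (b (g i) \<otimes> b (h i)) k)" for i k
  define P where "P f = (\<Prod>i<n. c i (f i))" for f
  define u where "u = tuple_mult A (mon_tuple g) (mon_tuple h)"
  have u: "u \<in> tuples A n"
    unfolding u_def using g h by (intro tuple_mult_closed mon_tuple_closed)
  have u_nth: "u ! i = (\<Oplus>k\<in>{..<n}. c i k \<odot> b k)" if i: "i < n" for i
  proof (cases "g i = 0 \<or> h i = 0")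
    case True
    have less: "g i + h i < n" using True Idx_less[OF g i] Idx_less[OF h i] by auto
    have ui: "u ! i = b (g i + h i)"
      using True i b_closed[OF Idx_less[OF g i]] b_closed[OF Idx_less[OF h i]]
      by (auto simp: u_def mon_tuple_def b_0)
    have "(\<Oplus>k\<in>{..<n}. c i k \<odot> b k) = (\<Oplus>k\<in>{..<n}. if g i + h i = k then b k else \<zero>)"
      using True b_closed smult_one smult_l_null
      by (intro M.finsum_cong') (auto simp: c_def join_coeff_def)
    also have "\<dots> = b (g i + h i)"
      using less b_closed by (intro M.finsum_singleton) auto
    finally show ?thesis using ui by simp
  next
    case False
    then show ?thesis
      using i coord[of "b (g i) \<otimes> b (h i)"] b_closed[OF Idx_less[OF g i]] b_closed[OF Idx_less[OF h i]]
      by (simp add: u_def mon_tuple_def c_def)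
  qed
  \<comment> \<open>a monomial occurring in the product has a nontrivial entry only where one of the factors has one\<close>
  have supp: "{i. i < n \<and> f i \<noteq> 0} \<subseteq> {i. i < n \<and> g i \<noteq> 0} \<union> {i. i < n \<and> h i \<noteq> 0}"
    if "P f \<noteq> 0" for f
  proof -
    have "c i (f i) \<noteq> 0" if "i < n" for i
      using \<open>P f \<noteq> 0\<close> that by (auto simp: P_def)
    then show ?thesis by (force simp: c_def join_coeff_def split: if_splits)
  qed
  \<comment> \<open>each overlap of the supports of \<open>g\<close> and \<open>h\<close> lowers the degree by one\<close>
  have card_union: "deg f + card ({i. i < n \<and> g i \<noteq> 0} \<inter> {i. i < n \<and> h i \<noteq> 0}) \<le> ?d"
    if "P f \<noteq> 0" for f
    using card_mono[OF _ supp[OF that]] card_Un_Int[of "{i. i < n \<and> g i \<noteq> 0}" "{i. i < n \<and> h i \<noteq> 0}"]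
    by (simp add: deg_def)
  have P_top: "P f = (\<Prod>i<n. join_coeff (g i) (h i) (f i))" if "deg f = ?d" for f
  proof (cases "\<forall>i<n. g i = 0 \<or> h i = 0")
    case True
    then show ?thesis by (simp add: P_def c_def)
  next
    case False
    then obtain i where i: "i < n" "g i \<noteq> 0" "h i \<noteq> 0" by blast
    then have "card ({i. i < n \<and> g i \<noteq> 0} \<inter> {i. i < n \<and> h i \<noteq> 0}) > 0"
      by (auto simp: card_gt_0_iff)
    then have "P f = 0" using card_union[of f] that by fastforce
    moreover have "(\<Prod>i<n. join_coeff (g i) (h i) (f i)) = (0::'k)"
      using i by (intro prod_zero) (auto simp: join_coeff_def)
    ultimately show ?thesis by simp
  qed
  have "eqmod (lower ?d) (\<Sum>f\<in>Idx. scale (P f) (mon f))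
      (\<Sum>f\<in>Idx. if deg f = ?d then scale (\<Prod>i<n. join_coeff (g i) (h i) (f i)) (mon f) else 0)"
  proof (rule eqmod_sum[OF subspace_lower])
    fix f assume f: "f \<in> Idx"
    consider "deg f < ?d" | "deg f = ?d" | "deg f > ?d" by linarith
    then show "eqmod (lower ?d) (scale (P f) (mon f))
        (if deg f = ?d then scale (\<Prod>i<n. join_coeff (g i) (h i) (f i)) (mon f) else 0)"
    proof cases
      case 1
      then show ?thesis
        using pm.subspace_scale[OF subspace_lower mon_in_lower[OF f]] by (auto simp: eqmod_def)
    next
      case 2
      then show ?thesis by (simp add: P_top eqmod_refl[OF subspace_lower])
    next
      case 3
      then have "P f = 0" using card_union[of f] by fastforce
      then show ?thesis using 3 by (simp add: eqmod_refl[OF subspace_lower])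
    qed
  qed
  moreover have "eqmod (lower ?d) (mon g \<otimes>\<^bsub>T\<^esub> mon h) (\<Sum>f\<in>Idx. scale (P f) (mon f))"
    using eqmod_mono[OF expand_tuple[OF u u_nth] J_subset_lower] by (simp add: P_def mon_def u_def)
  moreover have "(\<Sum>f\<in>Idx. if deg f = ?d then scale (\<Prod>i<n. join_coeff (g i) (h i) (f i)) (mon f) else 0) =
      (\<Sum>f | f \<in> Idx \<and> deg f = ?d. scale (\<Prod>i<n. join_coeff (g i) (h i) (f i)) (mon f))"
    using finite_Idx by (simp add: sum.inter_filter[symmetric] Collect_conj_eq)
  ultimately show ?thesis by (simp only: eqmod_trans[OF subspace_lower, of _ "mon g \<otimes>\<^bsub>T\<^esub> mon h" "\<Sum>f\<in>Idx. scale (P f) (mon f)"])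
qed

lemma mon_mult_lower:
  assumes g: "g \<in> Idx" and "p \<in> lower e"
  shows "mon g \<otimes>\<^bsub>T\<^esub> p \<in> lower (deg g + e)"
proof -
  interpret J: ideal J T by (rule ideal_J)
  let ?W = "{p. mon g \<otimes>\<^bsub>T\<^esub> p \<in> lower (deg g + e)}"
  have "lower e \<subseteq> ?W"
    unfolding lower_def[of e]
  proof (rule monspan_subset)
    fix h assume h: "h \<in> {f \<in> Idx. deg f < e}"
    have "lower (deg g + deg h) \<subseteq> lower (deg g + e)" using h by (intro lower_mono) simp
    moreover have "(\<Sum>f | f \<in> Idx \<and> deg f = deg g + deg h.
        scale (\<Prod>i<n. join_coeff (g i) (h i) (f i)) (mon f)) \<in> lower (deg g + e)"
      using h by (intro pm.subspace_sum pm.subspace_scale subspace_lower mon_in_lower) auto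
    ultimately show "mon h \<in> ?W"
      using eqmod_mem[OF subspace_lower eqmod_mono[OF mon_mult[OF g]]] h by blast
  next
    show "J \<subseteq> ?W" using J.I_l_closed[OF _ mon_closed[OF g]] J_subset_lower by blast
    show "pm.subspace ?W"
      using pm.subspace_0[OF subspace_lower] pm.subspace_add[OF subspace_lower]
        pm.subspace_scale[OF subspace_lower]
      by (simp add: pm.subspace_def tuple_algebra_mult_add tuple_algebra_mult_scale)
  qed
  then show ?thesis using assms(2) by blast
qed

end

section \<open>Degeneration to square zero multiplication\<close>

text \<open>Such sets \<open>S\<close> are determined by \<open>S - D\<close>.\<close>

lemma card_supersets:
  assumes "finite U" "D \<subseteq> U"
  shows "card {S. S \<subseteq> U \<and> D \<subseteq> S \<and> card S = j} =
    (if card D \<le> j then (card U - card D) choose (j - card D) else 0)"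
proof (cases "card D \<le> j")
  case True
  have finD: "finite D" using assms finite_subset by blast
  have "bij_betw (\<lambda>S. S - D) {S. S \<subseteq> U \<and> D \<subseteq> S \<and> card S = j} {S. S \<subseteq> U - D \<and> card S = j - card D}"
  proof (rule bij_betwI[where g = "\<lambda>S. S \<union> D"])
    show "(\<lambda>S. S - D) \<in> {S. S \<subseteq> U \<and> D \<subseteq> S \<and> card S = j} \<rightarrow> {S. S \<subseteq> U - D \<and> card S = j - card D}"
      using finD by (auto simp: card_Diff_subset)
    show "(\<lambda>S. S \<union> D) \<in> {S. S \<subseteq> U - D \<and> card S = j - card D} \<rightarrow> {S. S \<subseteq> U \<and> D \<subseteq> S \<and> card S = j}"
    proof
      fix S assume S: "S \<in> {S. S \<subseteq> U - D \<and> card S = j - card D}"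
      then have "finite S" using assms(1) finite_subset by blast
      then have "card (S \<union> D) = card S + card D" using S finD by (intro card_Un_disjoint) auto
      then show "S \<union> D \<in> {S. S \<subseteq> U \<and> D \<subseteq> S \<and> card S = j}" using S True assms by auto
    qed
  qed auto
  then have "card {S. S \<subseteq> U \<and> D \<subseteq> S \<and> card S = j} = card {S. S \<subseteq> U - D \<and> card S = j - card D}"
    by (rule bij_betw_same_card)
  also have "\<dots> = card (U - D) choose (j - card D)" using assms by (intro n_subsets) auto
  finally show ?thesis using True assms finD by (simp add: card_Diff_subset)
next
  case False
  have "card D \<le> card S" if "S \<subseteq> U" "D \<subseteq> S" for S
    using that assms by (meson card_mono finite_subset)
  then have empty: "{S. S \<subseteq> U \<and> D \<subseteq> S \<and> card S = j} = {}" using False by auto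
  show ?thesis unfolding empty using False by simp
qed

text \<open>Besides the basis \<open>x\<close>, the algebra \<open>R\<close> has coordinates \<open>\<kappa>\<close> that are unique, linear and multiply with the structure
constants of \<open>R\<^sub>n\<close>; together with the values of its \<open>s\<^sub>j\<close> this is all that the comparison uses of \<open>R\<^sub>n\<close>.\<close>

locale degeneration =
  A: monomial_power A n b coord + R: monomial_power R n x \<kappa>
  for A :: "('k::field, 'a) module" and n b coord and R :: "('k, 'r) module" and x \<kappa> +
  assumes \<kappa>_add: "\<lbrakk>r \<in> carrier R; s \<in> carrier R; k < n\<rbrakk> \<Longrightarrow> \<kappa> (r \<oplus>\<^bsub>R\<^esub> s) k = \<kappa> r k + \<kappa> s k"
    and \<kappa>_smult: "\<lbrakk>r \<in> carrier R; k < n\<rbrakk> \<Longrightarrow> \<kappa> (c \<odot>\<^bsub>R\<^esub> r) k = c * \<kappa> r k"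
    and \<kappa>_mult: "\<lbrakk>r \<in> carrier R; s \<in> carrier R; k < n\<rbrakk> \<Longrightarrow>
      \<kappa> (r \<otimes>\<^bsub>R\<^esub> s) k = (\<Sum>i<n. \<Sum>j<n. \<kappa> r i * \<kappa> s j * join_coeff i j k)"
    and \<kappa>_basis: "\<lbrakk>j < n; k < n\<rbrakk> \<Longrightarrow> \<kappa> (x j) k = (if j = k then 1 else 0)"
    and char_coeff_R: "\<lbrakk>r \<in> carrier R; 1 \<le> j; j \<le> n\<rbrakk> \<Longrightarrow>
      char_coeff R j r = of_nat (n choose j) * \<kappa> r 0 ^ j"
begin

abbreviation Idx where "Idx \<equiv> A.Idx"
abbreviation deg where "deg \<equiv> A.deg"

definition tuple_coord :: "'r list \<Rightarrow> (nat \<Rightarrow> nat) \<Rightarrow> 'k" where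
  "tuple_coord u f = (\<Prod>i<n. \<kappa> (u ! i) (f i))"

text \<open>The component of degree \<open>d\<close> of a formal combination of tuples over \<open>R\<close>, with the monomials of \<open>R\<^sub>n\<^sup>\<otimes>\<^sup>n\<close>
replaced by those of \<open>A\<^sup>\<otimes>\<^sup>n\<close>.\<close>

definition \<phi> :: "nat \<Rightarrow> ('r list \<Rightarrow>\<^sub>0 'k) \<Rightarrow> ('a list \<Rightarrow>\<^sub>0 'k)" where
  "\<phi> d = linext (\<lambda>u. \<Sum>f | f \<in> Idx \<and> deg f = d. scale (tuple_coord u f) (A.mon f))"

lemma \<phi>_single: "\<phi> d (Poly_Mapping.single u c) =
    scale c (\<Sum>f | f \<in> Idx \<and> deg f = d. scale (tuple_coord u f) (A.mon f))"
  by (simp add: \<phi>_def)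

lemma \<phi>_linear: "\<phi> d (p + q) = \<phi> d p + \<phi> d q" "\<phi> d (p - q) = \<phi> d p - \<phi> d q"
  "\<phi> d (scale c p) = scale c (\<phi> d p)" "\<phi> d 0 = 0" "\<phi> d (sum F S) = (\<Sum>s\<in>S. \<phi> d (F s))"
  unfolding \<phi>_def
  by (simp_all add: linext.add linext.diff linext.scale linext.zero linext.sum)

lemma deg_join:
  assumes "(\<Prod>i<n. join_coeff (g i) (h i) (f i)) \<noteq> (0::'k)"
  shows "deg f = deg g + deg h"
proof -
  have *: "(g i = 0 \<or> h i = 0) \<and> g i + h i = f i" if "i < n" for i
  proof -
    have "join_coeff (g i) (h i) (f i) \<noteq> (0::'k)" using assms that by auto
    then show ?thesis by (auto simp: join_coeff_def split: if_splits)
  qed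
  then have "{i. i < n \<and> f i \<noteq> 0} = {i. i < n \<and> g i \<noteq> 0} \<union> {i. i < n \<and> h i \<noteq> 0}"
    and "{i. i < n \<and> g i \<noteq> 0} \<inter> {i. i < n \<and> h i \<noteq> 0} = {}"
    by fastforce+
  then show ?thesis by (simp add: A.deg_def card_Un_disjoint)
qed

text \<open>Expand the product over the tensor factors of the double sums that give the coordinates of the entries.\<close>

lemma tuple_coord_mult:
  assumes "u \<in> tuples R n" "v \<in> tuples R n" "f \<in> Idx"
  shows "tuple_coord (tuple_mult R u v) f =
    (\<Sum>g\<in>Idx. \<Sum>h\<in>Idx. tuple_coord u g * tuple_coord v h * (\<Prod>i<n. join_coeff (g i) (h i) (f i)))"
proof -
  have "tuple_coord (tuple_mult R u v) f =
      (\<Prod>i<n. \<Sum>j<n. \<kappa> (u ! i) j * (\<Sum>l<n. \<kappa> (v ! i) l * join_coeff j l (f i)))"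
    unfolding tuple_coord_def using assms
    by (intro prod.cong) (auto simp: tuplesD \<kappa>_mult A.Idx_less sum_distrib_left mult.assoc)
  also have "\<dots> = (\<Sum>g\<in>Idx. \<Prod>i<n. \<kappa> (u ! i) (g i) * (\<Sum>l<n. \<kappa> (v ! i) l * join_coeff (g i) l (f i)))"
    by (subst prod_sum_PiE) (simp_all add: A.Idx_def)
  also have "\<dots> = (\<Sum>g\<in>Idx. tuple_coord u g * (\<Sum>h\<in>Idx. \<Prod>i<n. \<kappa> (v ! i) (h i) * join_coeff (g i) (h i) (f i)))"
    unfolding tuple_coord_def prod.distrib
    by (subst prod_sum_PiE) (simp_all add: A.Idx_def prod.distrib)
  finally show ?thesis
    by (simp add: prod.distrib tuple_coord_def sum_distrib_left mult.assoc)
qed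

text \<open>The maps \<open>\<phi> d\<close> are jointly multiplicative up to lower degree: both sides expand into products
of monomials, and \<open>mon_mult\<close> compares them.\<close>

lemma \<phi>_mult:
  assumes v: "v \<in> tuples R n" and p: "p \<in> carrier R.T"
  shows "eqmod (A.lower d) (\<phi> d (Poly_Mapping.single v 1 \<otimes>\<^bsub>R.T\<^esub> p))
    (\<Sum>g | g \<in> Idx \<and> deg g \<le> d. scale (tuple_coord v g) (A.mon g \<otimes>\<^bsub>A.T\<^esub> \<phi> (d - deg g) p))"
    (is "eqmod _ (?l p) (?r p)")
proof -
  have p': "Poly_Mapping.keys p \<subseteq> tuples R n" using p by simp
  note sub = A.subspace_lower
  have main: "eqmod (A.lower d) (?l (Poly_Mapping.single u 1)) (?r (Poly_Mapping.single u 1))"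
    if u: "u \<in> tuples R n" for u
  proof -
    let ?t = "\<lambda>g h. \<Sum>f | f \<in> Idx \<and> deg f = d. scale (\<Prod>i<n. join_coeff (g i) (h i) (f i)) (A.mon f)"
    have "?l (Poly_Mapping.single u 1) = (\<Sum>f | f \<in> Idx \<and> deg f = d. \<Sum>g\<in>Idx. \<Sum>h\<in>Idx.
        scale (tuple_coord v g * tuple_coord u h) (scale (\<Prod>i<n. join_coeff (g i) (h i) (f i)) (A.mon f)))"
      by (simp add: \<phi>_single tuple_coord_mult[OF v u] pm.scale_sum_left)
    also have "\<dots> = (\<Sum>g\<in>Idx. \<Sum>h\<in>Idx. scale (tuple_coord v g * tuple_coord u h) (?t g h))"
      unfolding pm.scale_sum_right
      by (subst sum.swap, rule sum.cong[OF refl], rule sum.swap)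
    finally have l: "?l (Poly_Mapping.single u 1) =
      (\<Sum>g\<in>Idx. \<Sum>h\<in>Idx. scale (tuple_coord v g * tuple_coord u h) (?t g h))" .
    have "?r (Poly_Mapping.single u 1) = (\<Sum>g | g \<in> Idx \<and> deg g \<le> d. \<Sum>h | h \<in> Idx \<and> deg h = d - deg g.
        scale (tuple_coord v g * tuple_coord u h) (A.mon g \<otimes>\<^bsub>A.T\<^esub> A.mon h))"
      by (simp add: \<phi>_single tuple_algebra_mult_sum tuple_algebra_mult_scale pm.scale_sum_right)
    also have "\<dots> = (\<Sum>g\<in>Idx. \<Sum>h\<in>Idx. if deg g + deg h = d then
        scale (tuple_coord v g * tuple_coord u h) (A.mon g \<otimes>\<^bsub>A.T\<^esub> A.mon h) else 0)"
    proof -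
      have inner: "(\<Sum>h\<in>Idx. if deg g + deg h = d then F h else 0) =
          (if deg g \<le> d then \<Sum>h | h \<in> Idx \<and> deg h = d - deg g. F h else (0::'a list \<Rightarrow>\<^sub>0 'k))" for g F
        using A.finite_Idx by (auto simp: sum.inter_filter[symmetric] intro!: sum.cong sum.neutral)
      show ?thesis unfolding inner by (rule sum.inter_filter[OF A.finite_Idx])
    qed
    finally have r: "?r (Poly_Mapping.single u 1) = (\<Sum>g\<in>Idx. \<Sum>h\<in>Idx. if deg g + deg h = d then
        scale (tuple_coord v g * tuple_coord u h) (A.mon g \<otimes>\<^bsub>A.T\<^esub> A.mon h) else 0)" .
    show ?thesis
      unfolding l r
    proof (intro eqmod_sum[OF sub])
      fix g h assume g: "g \<in> Idx" and h: "h \<in> Idx"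
      show "eqmod (A.lower d) (scale (tuple_coord v g * tuple_coord u h) (?t g h))
        (if deg g + deg h = d then scale (tuple_coord v g * tuple_coord u h) (A.mon g \<otimes>\<^bsub>A.T\<^esub> A.mon h) else 0)"
      proof (cases "deg g + deg h = d")
        case True
        then show ?thesis
          using eqmod_scale[OF sub eqmod_sym[OF sub A.mon_mult[OF g h]]] by simp
      next
        case False
        then have "(\<Prod>i<n. join_coeff (g i) (h i) (f i)) = (0::'k)" if "deg f = d" for f
          using deg_join[of g h f] that False by (metis (lifting))
        then have "?t g h = 0" by (intro sum.neutral) simp
        then show ?thesis using False by (simp add: eqmod_refl[OF sub])
      qed
    qed
  qed
  show ?thesis using p'
  proof (induction p rule: poly_mapping_span_induct)
    case zero
    then show ?case by (simp add: \<phi>_linear eqmod_refl[OF sub])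
  next
    case (single u c)
    have *: "Poly_Mapping.single u c = scale c (Poly_Mapping.single u 1)" by simp
    show ?case
      unfolding * tuple_algebra_mult_scale \<phi>_linear pm.scale_left_commute[of _ c]
        pm.scale_sum_right[symmetric]
      by (rule eqmod_scale[OF sub main[OF single]])
  next
    case (add p q)
    show ?case
      unfolding tuple_algebra_mult_add \<phi>_linear pm.scale_right_distrib sum.distrib
      by (rule eqmod_add[OF sub add.IH])
  qed
qed

text \<open>The elements whose image in the associated graded space of \<open>G(A/K)\<close> is zero.\<close>

definition L :: "('r list \<Rightarrow>\<^sub>0 'k) set" where
  "L = {p \<in> carrier R.T. \<forall>d. \<phi> d p \<in> A.lower d}"

lemma subspace_L: "pm.subspace L"
  unfolding L_def pm.subspace_def
  using pm.subspace_0[OF A.subspace_lower] pm.subspace_add[OF A.subspace_lower]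
    pm.subspace_scale[OF A.subspace_lower]
  by (simp add: \<phi>_linear keys_add_subset keys_scale_subset)

lemma L_mult:
  assumes "q \<in> carrier R.T" and p: "p \<in> L"
  shows "q \<otimes>\<^bsub>R.T\<^esub> p \<in> L"
proof -
  have pT: "p \<in> carrier R.T" using p by (simp add: L_def)
  have "Poly_Mapping.keys q \<subseteq> tuples R n" using assms by simp
  then show ?thesis
  proof (induction q rule: poly_mapping_span_induct)
    case zero
    then show ?case using pm.subspace_0[OF subspace_L] by simp
  next
    case (single v c)
    have "\<phi> d (Poly_Mapping.single v 1 \<otimes>\<^bsub>R.T\<^esub> p) \<in> A.lower d" for d
    proof (rule eqmod_mem[OF A.subspace_lower \<phi>_mult[OF single pT]])
      have "A.mon g \<otimes>\<^bsub>A.T\<^esub> \<phi> (d - deg g) p \<in> A.lower d" if "g \<in> Idx" "deg g \<le> d" for g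
        using A.mon_mult_lower[OF that(1), of "\<phi> (d - deg g) p" "d - deg g"] p that(2)
        by (simp add: L_def)
      then show "(\<Sum>g | g \<in> Idx \<and> deg g \<le> d. scale (tuple_coord v g)
          (A.mon g \<otimes>\<^bsub>A.T\<^esub> \<phi> (d - deg g) p)) \<in> A.lower d"
        by (intro pm.subspace_sum pm.subspace_scale A.subspace_lower) auto
    qed
    moreover have "Poly_Mapping.single v 1 \<otimes>\<^bsub>R.T\<^esub> p \<in> carrier R.T"
      using single pT by (intro R.tuple_algebra_closed) simp_all
    ultimately have "Poly_Mapping.single v 1 \<otimes>\<^bsub>R.T\<^esub> p \<in> L" by (simp add: L_def)
    from pm.subspace_scale[OF subspace_L this, of c] show ?case
      by (simp add: tuple_algebra_mult_scale[symmetric])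
  next
    case (add q q')
    then show ?case using pm.subspace_add[OF subspace_L] by (simp add: tuple_algebra_mult_add)
  qed
qed

lemma ideal_L: "ideal L R.T"
  by (rule ideal_by_subtraction[OF R.T.M_cring])
    (use pm.subspace_0[OF subspace_L] pm.subspace_diff[OF subspace_L] L_mult in \<open>auto simp: L_def\<close>)

lemma tuple_coord_update:
  assumes "u \<in> tuples R n" "i < n"
  shows "tuple_coord (u[i := r]) f = \<kappa> r (f i) * (\<Prod>j\<in>{..<n} - {i}. \<kappa> (u ! j) (f j))"
  unfolding tuple_coord_def using assms
  by (subst prod.remove[of _ i]) (auto simp: tuplesD nth_list_update intro!: prod.cong)

text \<open>The maps \<open>\<phi> d\<close> vanish on these relations, because the coordinates \<open>\<kappa>\<close> are linear in each entry of a tuple.\<close>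

lemma relations_in_L: "multilinear_relations R n \<subseteq> L"
proof
  fix p assume p: "p \<in> multilinear_relations R n"
  have "\<phi> d p = 0" for d
  proof -
    consider u i r s where "p = Poly_Mapping.single (u[i := r \<oplus>\<^bsub>R\<^esub> s]) 1
        - Poly_Mapping.single (u[i := r]) 1 - Poly_Mapping.single (u[i := s]) 1"
        "u \<in> tuples R n" "i < n" "r \<in> carrier R" "s \<in> carrier R"
      | u i c r where "p = Poly_Mapping.single (u[i := c \<odot>\<^bsub>R\<^esub> r]) 1 - Poly_Mapping.single (u[i := r]) c"
        "u \<in> tuples R n" "i < n" "r \<in> carrier R"
      using p unfolding multilinear_relations_def by blast
    then show ?thesis
    proof cases
      case 1
      then have "tuple_coord (u[i := r \<oplus>\<^bsub>R\<^esub> s]) f = tuple_coord (u[i := r]) f + tuple_coord (u[i := s]) f"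
        if "f \<in> Idx" for f
        using that by (simp add: tuple_coord_update \<kappa>_add A.Idx_less distrib_right)
      then show ?thesis
        unfolding 1(1) \<phi>_linear \<phi>_single
        by (simp add: pm.scale_left_distrib sum.distrib)
    next
      case 2
      then have "tuple_coord (u[i := c \<odot>\<^bsub>R\<^esub> r]) f = c * tuple_coord (u[i := r]) f"
        if "f \<in> Idx" for f
        using that by (simp add: tuple_coord_update \<kappa>_smult A.Idx_less mult.assoc)
      then show ?thesis
        unfolding 2(1) \<phi>_linear \<phi>_single
        by (simp add: pm.scale_sum_right)
    qed
  qed
  then show "p \<in> L"
    using p R.multilinear_relations_closed pm.subspace_0[OF A.subspace_lower]
    by (auto simp: L_def)
qed

lemma tuple_coord_mon:
  assumes "f \<in> Idx" "g \<in> Idx"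
  shows "tuple_coord (R.mon_tuple g) f = (if f = g then 1 else 0)"
proof -
  have eq: "\<kappa> (R.mon_tuple g ! i) (f i) = (if f i = g i then 1 else 0)" if "i < n" for i
    using that assms by (simp add: R.mon_tuple_def \<kappa>_basis A.Idx_less)
  show ?thesis
  proof (cases "f = g")
    case True
    then show ?thesis using eq unfolding tuple_coord_def by simp
  next
    case False
    then obtain i where "f i \<noteq> g i" by blast
    moreover from this have "i < n"
      using assms PiE_arb[of f "{..<n}" _ i] PiE_arb[of g "{..<n}" _ i] by (auto simp: A.Idx_def)
    ultimately show ?thesis
      using False unfolding tuple_coord_def by (auto intro!: prod_zero simp: eq)
  qed
qed

lemma \<phi>_mon:
  assumes "g \<in> Idx"
  shows "\<phi> d (R.mon g) = (if deg g = d then A.mon g else 0)"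
proof -
  have "\<phi> d (R.mon g) = (\<Sum>f | f \<in> Idx \<and> deg f = d. if f = g then A.mon g else 0)"
    unfolding R.mon_def \<phi>_single pm.scale_one
    by (intro sum.cong refl) (simp add: tuple_coord_mon[OF _ assms])
  also have "\<dots> = (if deg g = d then A.mon g else 0)"
    using assms A.finite_Idx by (simp add: sum.delta)
  finally show ?thesis .
qed

definition zero_idx :: "nat \<Rightarrow> nat" where
  "zero_idx = restrict (\<lambda>_. 0) {..<n}"

lemma zero_idx: "zero_idx \<in> Idx" "deg zero_idx = 0"
  using A.n_pos by (auto simp: zero_idx_def A.Idx_def A.deg_def)

lemma mon_zero_idx: "A.mon_tuple zero_idx = replicate n \<one>\<^bsub>A\<^esub>" "R.mon_tuple zero_idx = replicate n \<one>\<^bsub>R\<^esub>"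
  by (auto simp: A.mon_tuple_def R.mon_tuple_def zero_idx_def A.b_0 R.b_0 intro!: nth_equalityI)

definition supp :: "(nat \<Rightarrow> nat) \<Rightarrow> nat set" where
  "supp f = {i. i < n \<and> f i \<noteq> 0}"

lemma supp_simps: "finite (supp f)" "supp f \<subseteq> {..<n}" "card (supp f) = deg f"
  by (auto simp: supp_def A.deg_def)

text \<open>The coefficient of the monomial \<open>f\<close> in \<open>e\<^sub>d(m)\<close> for \<open>d = deg f\<close> and \<open>m\<close> the part of \<open>r\<close> in the maximal ideal.\<close>

definition weight :: "'r \<Rightarrow> (nat \<Rightarrow> nat) \<Rightarrow> 'k" where
  "weight r f = (\<Prod>i\<in>supp f. \<kappa> r (f i))"

definition elementary :: "'r \<Rightarrow> nat \<Rightarrow> ('a list \<Rightarrow>\<^sub>0 'k)" where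
  "elementary r d = (\<Sum>f | f \<in> Idx \<and> deg f = d. scale (weight r f) (A.mon f))"

lemma \<kappa>_one: "k < n \<Longrightarrow> \<kappa> \<one>\<^bsub>R\<^esub> k = (if k = 0 then 1 else 0)"
  using \<kappa>_basis[of 0 k] R.n_pos R.b_0 by auto

text \<open>In the tensor factors in \<open>S\<close> the monomial takes its entry from \<open>r\<close>, outside \<open>S\<close> it has to have the entry \<open>1\<close>.\<close>

lemma tuple_coord_spread:
  assumes f: "f \<in> Idx" and S: "S \<subseteq> {..<n}"
  shows "tuple_coord (R.spread S r) f =
    (if supp f \<subseteq> S then \<kappa> r 0 ^ (card S - deg f) * weight r f else 0)"
proof -
  have nth: "\<kappa> (R.spread S r ! i) (f i) = (if i \<in> S then \<kappa> r (f i) else if f i = 0 then 1 else 0)"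
    if "i < n" for i
    using that A.Idx_less[OF f that] by (simp add: R.spread_def \<kappa>_one)
  show ?thesis
  proof (cases "supp f \<subseteq> S")
    case True
    have finS: "finite S" using S finite_subset by blast
    have "tuple_coord (R.spread S r) f = (\<Prod>i<n. if i \<in> S then \<kappa> r (f i) else 1)"
      unfolding tuple_coord_def using True
      by (intro prod.cong refl) (auto simp: nth supp_def)
    also have "\<dots> = (\<Prod>i\<in>S. \<kappa> r (f i))"
      using S by (simp add: prod.If_cases Int_absorb1)
    also have "\<dots> = (\<Prod>i\<in>S - supp f. \<kappa> r (f i)) * weight r f"
      unfolding weight_def by (rule prod.subset_diff[OF True finS])
    also have "(\<Prod>i\<in>S - supp f. \<kappa> r (f i)) = (\<Prod>i\<in>S - supp f. \<kappa> r 0)"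
      using S by (intro prod.cong refl) (auto simp: supp_def)
    also have "\<dots> = \<kappa> r 0 ^ (card S - deg f)"
      using True by (simp add: card_Diff_subset supp_simps)
    finally show ?thesis using True by simp
  next
    case False
    then obtain i where "i < n" "f i \<noteq> 0" "i \<notin> S" by (auto simp: supp_def)
    then have "tuple_coord (R.spread S r) f = 0"
      unfolding tuple_coord_def by (intro prod_zero) (auto simp: nth)
    then show ?thesis using False by simp
  qed
qed

text \<open>A fixed monomial \<open>f\<close> of degree \<open>d\<close> occurs in the products over all \<open>S\<close> that contain its support, always
with the coefficient \<open>\<kappa> r 0 ^ (j - d) * weight r f\<close>; the number of these \<open>S\<close> depends only on \<open>d\<close> and is
\<open>n choose j\<close> for \<open>d = 0\<close>, where the sum cancels against \<open>s\<^sub>j(r)\<close>.\<close>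

lemma \<phi>_closure_relation:
  assumes r: "r \<in> carrier R" and j: "1 \<le> j" "j \<le> n"
  shows "\<exists>c. \<phi> d (R.closure_relation j r) = (if d = 0 then 0 else scale c (elementary r d))"
proof -
  let ?Ss = "{S. S \<subseteq> {..<n} \<and> card S = j}"
  define N where "N = (if d \<le> j then of_nat ((n - d) choose (j - d)) * \<kappa> r 0 ^ (j - d) else 0 :: 'k)"
  have coeff: "(\<Sum>S\<in>?Ss. tuple_coord (R.spread S r) f) = N * weight r f"
    if f: "f \<in> Idx" and d: "deg f = d" for f
  proof -
    have "(\<Sum>S\<in>?Ss. tuple_coord (R.spread S r) f) =
        (\<Sum>S\<in>?Ss. if supp f \<subseteq> S then \<kappa> r 0 ^ (j - d) * weight r f else 0)"
      using f d by (intro sum.cong refl) (simp add: tuple_coord_spread)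
    also have "\<dots> = (\<Sum>S | S \<subseteq> {..<n} \<and> supp f \<subseteq> S \<and> card S = j. \<kappa> r 0 ^ (j - d) * weight r f)"
    proof -
      have "{S. S \<subseteq> {..<n} \<and> supp f \<subseteq> S \<and> card S = j} = {S \<in> ?Ss. supp f \<subseteq> S}" by blast
      then show ?thesis by (simp only:) (rule sum.inter_filter[symmetric], simp)
    qed
    also have "\<dots> = N * weight r f"
      using card_supersets[of "{..<n}" "supp f" j] d by (simp add: supp_simps N_def)
    finally show ?thesis .
  qed
  have "\<phi> d (\<Sum>S\<in>?Ss. Poly_Mapping.single (R.spread S r) 1) =
      (\<Sum>f | f \<in> Idx \<and> deg f = d. scale (\<Sum>S\<in>?Ss. tuple_coord (R.spread S r) f) (A.mon f))"
    unfolding \<phi>_linear \<phi>_single pm.scale_one pm.scale_sum_left by (rule sum.swap)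
  also have "\<dots> = scale N (elementary r d)"
    unfolding elementary_def pm.scale_sum_right by (intro sum.cong refl) (simp add: coeff)
  finally have sum: "\<phi> d (\<Sum>S\<in>?Ss. Poly_Mapping.single (R.spread S r) 1) = scale N (elementary r d)" .
  have one: "\<phi> d (Poly_Mapping.single (replicate n \<one>\<^bsub>R\<^esub>) c) = scale c (if d = 0 then A.mon zero_idx else 0)" for c
    using \<phi>_mon[OF zero_idx(1), of d] \<phi>_linear(3)[of d c "R.mon zero_idx"]
    by (auto simp: R.mon_def mon_zero_idx zero_idx)
  show ?thesis
  proof (cases "d = 0")
    case True
    have zero: "f = zero_idx" if "f \<in> Idx" "deg f = 0" for f
    proof
      fix i
      show "f i = zero_idx i"
      proof (cases "i < n")
        case True
        have "{i. i < n \<and> f i \<noteq> 0} = {}" using that(2) by (simp add: A.deg_def)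
        then show ?thesis using True by (auto simp: zero_idx_def)
      next
        case False
        then show ?thesis using that(1) PiE_arb[of f "{..<n}" _ i] by (auto simp: A.Idx_def zero_idx_def)
      qed
    qed
    have only: "{f \<in> Idx. deg f = 0} = {zero_idx}" using zero zero_idx by blast
    have "elementary r 0 = (\<Sum>f\<in>{zero_idx}. scale (weight r f) (A.mon f))"
      unfolding elementary_def only ..
    also have "\<dots> = A.mon zero_idx" by (simp add: weight_def supp_def zero_idx_def)
    finally show ?thesis
      using True sum one j r
      by (simp add: R.closure_relation_def \<phi>_linear N_def char_coeff_R)
  next
    case False
    then have "\<phi> d (R.closure_relation j r) = scale (- N) (elementary r d)"
      using sum one by (simp add: R.closure_relation_def \<phi>_linear)
    then show ?thesis using False by (intro exI[of _ "- N"]) simp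
  qed
qed

text \<open>Here the closure relations of \<open>A\<close> enter. The witness \<open>a\<close> has the coordinates of \<open>r\<close>, except for the coordinate at
the unit, which is set to \<open>0\<close>. Then \<open>elementary r d\<close> is the expansion of the symmetric expression of
degree \<open>d\<close> in \<open>a\<close>, which modulo \<open>J\<close> is a scalar and hence of degree \<open>0\<close>.\<close>

lemma elementary_in_lower:
  assumes "1 \<le> d"
  shows "elementary r d \<in> A.lower d"
proof (cases "d \<le> n")
  case True
  let ?Ss = "{S. S \<subseteq> {..<n} \<and> card S = d}"
  define e where "e k = (if k = 0 then 0 else \<kappa> r k)" for k
  define a where "a = (\<Oplus>\<^bsub>A\<^esub>k\<in>{..<n}. e k \<odot>\<^bsub>A\<^esub> b k)"
  have a: "a \<in> carrier A" unfolding a_def using A.b_closed by (intro A.M.finsum_closed) auto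
  define c where "c S i k = (if i \<in> S then e k else if k = 0 then 1 else 0)" for S :: "nat set" and i k :: nat
  have expand: "eqmod (A.lower d) (Poly_Mapping.single (A.spread S a) 1)
      (\<Sum>f\<in>Idx. scale (\<Prod>i<n. c S i (f i)) (A.mon f))" for S
  proof (rule eqmod_mono[OF A.expand_tuple A.J_subset_lower])
    show "A.spread S a \<in> tuples A n" by (rule A.spread_closed[OF a])
    fix i assume i: "i < n"
    show "A.spread S a ! i = (\<Oplus>\<^bsub>A\<^esub>k\<in>{..<n}. c S i k \<odot>\<^bsub>A\<^esub> b k)"
    proof (cases "i \<in> S")
      case True
      then show ?thesis using i by (simp add: A.spread_def a_def c_def)
    next
      case False
      have "(\<Oplus>\<^bsub>A\<^esub>k\<in>{..<n}. c S i k \<odot>\<^bsub>A\<^esub> b k) = (\<Oplus>\<^bsub>A\<^esub>k\<in>{..<n}. if 0 = k then b k else \<zero>\<^bsub>A\<^esub>)"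
        using False A.b_closed A.smult_one A.smult_l_null
        by (intro A.M.finsum_cong') (auto simp: c_def)
      also have "\<dots> = b 0" using A.n_pos A.b_closed by (intro A.M.finsum_singleton) auto
      finally show ?thesis using False i by (simp add: A.spread_def A.b_0)
    qed
  qed
  have prod_eq: "(\<Prod>i<n. c S i (f i)) = (if supp f = S then weight r f else 0)"
    if "S \<subseteq> {..<n}" for S f
  proof (cases "supp f = S")
    case True
    have "(\<Prod>i<n. c S i (f i)) = (\<Prod>i<n. if i \<in> S then \<kappa> r (f i) else 1)"
      unfolding True[symmetric] by (intro prod.cong refl) (auto simp: c_def e_def supp_def)
    also have "\<dots> = (\<Prod>i\<in>S. \<kappa> r (f i))"
      using that by (simp add: prod.If_cases Int_absorb1)
    finally show ?thesis using True by (simp add: weight_def)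
  next
    case False
    have "supp f = S" if "\<forall>i<n. (i \<in> S) = (f i \<noteq> 0)"
      using that \<open>S \<subseteq> {..<n}\<close> by (auto simp: supp_def)
    then obtain i where i: "i < n" "(i \<in> S) \<noteq> (f i \<noteq> 0)" using False by blast
    then have "c S i (f i) = 0" by (auto simp: c_def e_def)
    then have "(\<Prod>i<n. c S i (f i)) = 0" using i(1) by (intro prod_zero) auto
    then show ?thesis using False by simp
  qed
  have "eqmod (A.lower d) (\<Sum>S\<in>?Ss. Poly_Mapping.single (A.spread S a) 1)
      (\<Sum>S\<in>?Ss. \<Sum>f\<in>Idx. scale (\<Prod>i<n. c S i (f i)) (A.mon f))"
    by (rule eqmod_sum[OF A.subspace_lower expand])
  also have "(\<Sum>S\<in>?Ss. \<Sum>f\<in>Idx. scale (\<Prod>i<n. c S i (f i)) (A.mon f)) =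
      (\<Sum>f\<in>Idx. \<Sum>S\<in>?Ss. if supp f = S then scale (weight r f) (A.mon f) else 0)"
    by (subst sum.swap) (intro sum.cong refl, simp add: prod_eq)
  also have "\<dots> = (\<Sum>f\<in>Idx. if deg f = d then scale (weight r f) (A.mon f) else 0)"
    by (intro sum.cong refl) (simp add: sum.delta supp_simps)
  also have "\<dots> = elementary r d"
    unfolding elementary_def by (rule sum.inter_filter[OF A.finite_Idx, symmetric])
  finally have 1: "eqmod (A.lower d) (elementary r d) (\<Sum>S\<in>?Ss. Poly_Mapping.single (A.spread S a) 1)"
    by (rule eqmod_sym[OF A.subspace_lower])
  have "A.closure_relation d a \<in> A.lower d"
    using A.closure_relation_in_J[OF a assms True] A.J_subset_lower by blast
  then have "eqmod (A.lower d) (Poly_Mapping.single (replicate n \<one>\<^bsub>A\<^esub>) (char_coeff A d a))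
      (\<Sum>S\<in>?Ss. Poly_Mapping.single (A.spread S a) 1)"
    by (simp add: eqmod_def A.closure_relation_def)
  note 2 = eqmod_sym[OF A.subspace_lower this]
  have "A.mon zero_idx \<in> A.lower d" using assms zero_idx by (intro A.mon_in_lower) auto
  from pm.subspace_scale[OF A.subspace_lower this, of "char_coeff A d a"]
  have "Poly_Mapping.single (replicate n \<one>\<^bsub>A\<^esub>) (char_coeff A d a) \<in> A.lower d"
    by (simp add: A.mon_def mon_zero_idx)
  then show ?thesis
    using eqmod_mem[OF A.subspace_lower eqmod_trans[OF A.subspace_lower 1 2]] by blast
next
  case False
  have "deg f \<le> n" for f
    using card_mono[OF _ supp_simps(2), of f] by (simp add: supp_simps)
  then have none: "{f \<in> Idx. deg f = d} = {}" using False by auto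
  show ?thesis
    unfolding elementary_def none using pm.subspace_0[OF A.subspace_lower] by simp
qed

lemma closure_relation_in_L:
  assumes "r \<in> carrier R" "1 \<le> j" "j \<le> n"
  shows "R.closure_relation j r \<in> L"
proof -
  have "\<phi> d (R.closure_relation j r) \<in> A.lower d" for d
  proof -
    obtain c where "\<phi> d (R.closure_relation j r) = (if d = 0 then 0 else scale c (elementary r d))"
      using \<phi>_closure_relation[OF assms] by blast
    then show ?thesis
      using pm.subspace_0[OF A.subspace_lower]
        pm.subspace_scale[OF A.subspace_lower elementary_in_lower[of d r], of c]
      by (cases "d = 0") simp_all
  qed
  then show ?thesis using R.closure_relation_closed[OF assms(1)] by (simp add: L_def)
qed

lemma J_subset_L: "R.J \<subseteq> L"
  by (rule R.J_minimal[OF ideal_L relations_in_L closure_relation_in_L])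

text \<open>Let \<open>d = deg f\<close>. A congruence of the monomial \<open>f\<close> over \<open>R\<close> to a combination of monomials from \<open>C\<close> holds
modulo \<open>J \<subseteq> L\<close>. Its image under \<open>\<phi> d\<close> is the congruence for \<open>A\<close> up to monomials of degree below \<open>d\<close>,
which are dealt with by induction.\<close>

lemma monspan_transfer:
  assumes C: "C \<subseteq> Idx" and span: "\<And>f. f \<in> Idx \<Longrightarrow> R.mon f \<in> R.monspan C"
  shows "f \<in> Idx \<Longrightarrow> A.mon f \<in> A.monspan C"
proof (induction "deg f" arbitrary: f rule: less_induct)
  case less
  let ?W = "{p. \<phi> (deg f) p \<in> A.monspan C}"
  note sub = A.subspace_monspan
  have lower: "A.lower (deg f) \<subseteq> A.monspan C"
    unfolding A.lower_def
  proof (rule A.monspan_subset[OF _ A.J_subset_monspan sub])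
    fix g assume "g \<in> {g \<in> Idx. deg g < deg f}"
    then show "A.mon g \<in> A.monspan C" using less.hyps[of g] by simp
  qed
  have "R.monspan C \<subseteq> ?W"
  proof (rule R.monspan_subset)
    fix g assume g: "g \<in> C"
    then have "\<phi> (deg f) (R.mon g) = (if deg g = deg f then A.mon g else 0)"
      using C by (intro \<phi>_mon) blast
    then show "R.mon g \<in> ?W"
      using A.mon_in_monspan[OF g] pm.subspace_0[OF sub] by simp
  next
    show "R.J \<subseteq> ?W"
    proof
      fix p assume "p \<in> R.J"
      then have "\<phi> (deg f) p \<in> A.lower (deg f)" using J_subset_L by (auto simp: L_def)
      then show "p \<in> ?W" using lower by blast
    qed
    show "pm.subspace ?W"
      using pm.subspace_0[OF sub] pm.subspace_add[OF sub] pm.subspace_scale[OF sub]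
      by (simp add: pm.subspace_def \<phi>_linear)
  qed
  then have "\<phi> (deg f) (R.mon f) \<in> A.monspan C" using span[OF less.prems] by blast
  then show ?case using \<phi>_mon[OF less.prems] by simp
qed

end

section \<open>Characteristic polynomials of elements with square zero nilpotent part\<close>

lemma monic_dvd_linear_power:
  fixes p :: "'k::field poly"
  assumes "monic p" "p dvd [:- c, 1:] ^ N"
  shows "p = [:- c, 1:] ^ degree p"
  using assms
proof (induction N arbitrary: p)
  case 0
  then have "degree p = 0" by (simp add: poly_dvd_1)
  then show ?case using 0 by (metis degree_0_id lead_coeff_pCons(2) one_pCons power_0 pCons_0_0)
next
  case (Suc N)
  let ?q = "[:- c, 1:]"
  have prime: "prime_elem ?q" by (rule prime_elem_linear_field_poly) simp
  obtain r where "?q ^ Suc N = p * r" using Suc.prems(2) by (rule dvdE)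
  then have r: "?q * ?q ^ N = p * r" by (simp only: power_Suc)
  show ?case
  proof (cases "?q dvd p")
    case True
    then obtain p' where p': "p = ?q * p'" by (rule dvdE)
    have "p' \<noteq> 0" using Suc.prems(1) p' by auto
    have "monic p'" using Suc.prems(1) unfolding p' lead_coeff_mult by simp
    moreover have "?q * ?q ^ N = ?q * (p' * r)" using r p' by (simp only: mult.assoc)
    then have "p' dvd ?q ^ N" by (metis dvd_triv_left mult_left_cancel prime prime_elem_not_zeroI)
    ultimately have "p' = ?q ^ degree p'" by (rule Suc.IH)
    moreover have "degree p = Suc (degree p')"
      unfolding p' using \<open>p' \<noteq> 0\<close> by (subst degree_mult_eq) auto
    ultimately show ?thesis using p' by simp
  next
    case False
    then have "?q dvd r" using prime_elem_dvd_multD[OF prime, of p r] r by (metis dvd_triv_left)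
    then obtain r' where "r = ?q * r'" by (rule dvdE)
    then have "?q * ?q ^ N = ?q * (p * r')" using r by (simp only: ac_simps)
    then have "p dvd ?q ^ N" by (metis dvd_triv_left mult_left_cancel prime prime_elem_not_zeroI)
    then show ?thesis by (rule Suc.IH[OF Suc.prems(1)])
  qed
qed

text \<open>The entrywise assumption says \<open>(M - c)\<^sup>2 = 0\<close>. It gives \<open>(x - M) (x - 2 c + M) = (x - c)\<^sup>2\<close>, so that the
determinant of the first factor is a monic divisor of \<open>(x - c)\<^sup>2\<^sup>n\<close> of degree \<open>n\<close>. This works over any field and
does not involve eigenvalues.\<close>

lemma char_poly_square_zero_shift:
  fixes M :: "'k::field mat"
  assumes M: "M \<in> carrier_mat n n"
    and sq: "\<And>i j. i < n \<Longrightarrow> j < n \<Longrightarrow>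
      (\<Sum>l<n. M $$ (i, l) * M $$ (l, j)) = 2 * c * M $$ (i, j) - (if i = j then c\<^sup>2 else 0)"
  shows "char_poly M = [:- c, 1:] ^ n"
proof -
  define X where "X = char_poly_matrix M"
  define Y where "Y = mat n n (\<lambda>(i, j). (if i = j then [:- 2 * c, 1:] else 0) + [:M $$ (i, j):])"
  have X: "X \<in> carrier_mat n n" using M by (simp add: X_def char_poly_matrix_def)
  have Y: "Y \<in> carrier_mat n n" by (simp add: Y_def)
  have X_index: "X $$ (i, j) = (if i = j then [:0, 1:] else 0) - [:M $$ (i, j):]"
    if "i < n" "j < n" for i j
    using M that by (simp add: X_def char_poly_matrix_def)
  have "X * Y = ([:- c, 1:]\<^sup>2) \<cdot>\<^sub>m 1\<^sub>m n"
  proof (rule eq_matI)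
    fix i j assume "i < dim_row (([:- c, 1:]\<^sup>2) \<cdot>\<^sub>m 1\<^sub>m n)" "j < dim_col (([:- c, 1:]\<^sup>2) \<cdot>\<^sub>m 1\<^sub>m n)"
    then have i: "i < n" and j: "j < n" by simp_all
    have const: "(\<Sum>l<n. [:M $$ (i, l):] * [:M $$ (l, j):]) =
        [:2 * c * M $$ (i, j) - (if i = j then c\<^sup>2 else 0):]"
    proof -
      have "(\<Sum>l<n. [:M $$ (i, l):] * [:M $$ (l, j):]) = [:\<Sum>l<n. M $$ (i, l) * M $$ (l, j):]"
        by (induction n) simp_all
      then show ?thesis using sq[OF i j] by simp
    qed
    have "(X * Y) $$ (i, j) = (\<Sum>l<n. X $$ (i, l) * Y $$ (l, j))"
      using X Y i j by (simp add: scalar_prod_def lessThan_atLeast0)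
    also have "\<dots> = (\<Sum>l<n. ((if i = l then [:0, 1:] else 0) - [:M $$ (i, l):]) *
        ((if l = j then [:- 2 * c, 1:] else 0) + [:M $$ (l, j):]))"
      using i j by (intro sum.cong refl) (simp add: X_index Y_def)
    also have "\<dots> = (\<Sum>l<n. (if i = l then [:0, 1:] * (if l = j then [:- 2 * c, 1:] else 0) else 0)
        + (if i = l then [:0, 1:] * [:M $$ (l, j):] else 0)
        - (if l = j then [:M $$ (i, l):] * [:- 2 * c, 1:] else 0)
        - [:M $$ (i, l):] * [:M $$ (l, j):])"
      by (intro sum.cong refl) (simp add: algebra_simps)
    also have "\<dots> = (if i = j then [:0, 1:] * [:- 2 * c, 1:] else 0) + [:0, 1:] * [:M $$ (i, j):]
        - [:M $$ (i, j):] * [:- 2 * c, 1:] - [:2 * c * M $$ (i, j) - (if i = j then c\<^sup>2 else 0):]"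
      using i j const by (simp add: sum.distrib sum_subtractf sum.delta sum.delta' del: mult_pCons_left mult_pCons_right)
    also have "\<dots> = (([:- c, 1:]\<^sup>2) \<cdot>\<^sub>m 1\<^sub>m n) $$ (i, j)"
      using i j by (simp add: power2_eq_square algebra_simps)
    finally show "(X * Y) $$ (i, j) = (([:- c, 1:]\<^sup>2) \<cdot>\<^sub>m 1\<^sub>m n) $$ (i, j)" .
  qed (use X Y in simp_all)
  then have "det X * det Y = ([:- c, 1:]\<^sup>2) ^ n"
    using det_mult[OF X Y] by (simp add: det_smult)
  then have "char_poly M dvd [:- c, 1:] ^ (2 * n)"
    unfolding char_poly_def X_def[symmetric] power_mult by (metis dvd_triv_left)
  moreover have "degree (char_poly M) = n" "monic (char_poly M)"
    using degree_monic_char_poly[OF M] by simp_all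
  ultimately show ?thesis using monic_dvd_linear_power by metis
qed

section \<open>Ordered bases\<close>

context vectorspace
begin

text \<open>Translates sums along a list without repetitions, as in the definition of characteristic polynomials
of elements, into linear combinations over a set.\<close>

lemma lincomb_list:
  assumes "distinct bs" "set bs \<subseteq> carrier V" "\<And>i. i < length bs \<Longrightarrow> d i \<in> carrier K"
  obtains a where "a \<in> set bs \<rightarrow> carrier K" "\<And>i. i < length bs \<Longrightarrow> a (bs ! i) = d i"
    "lincomb a (set bs) = (\<Oplus>\<^bsub>V\<^esub>i\<in>{..<length bs}. d i \<odot>\<^bsub>V\<^esub> bs ! i)"
proof
  have bs_closed: "bs ! i \<in> carrier V" if "i < length bs" for i
    using assms(2) nth_mem[OF that] by blast
  define a where "a v = d (the_inv_into {..<length bs} ((!) bs) v)" for v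
  have inj: "inj_on ((!) bs) {..<length bs}" using assms(1) by (simp add: inj_on_nth)
  show a_nth: "a (bs ! i) = d i" if "i < length bs" for i
    using the_inv_into_f_f[OF inj, of i] that by (simp add: a_def)
  show a: "a \<in> set bs \<rightarrow> carrier K" using a_nth assms(3) by (auto simp: in_set_conv_nth)
  have "set bs = (!) bs ` {..<length bs}" by (auto simp: set_conv_nth)
  then have "lincomb a (set bs) = (\<Oplus>\<^bsub>V\<^esub>v\<in>(!) bs ` {..<length bs}. a v \<odot>\<^bsub>V\<^esub> v)"
    by (simp add: lincomb_def)
  also have "\<dots> = (\<Oplus>\<^bsub>V\<^esub>i\<in>{..<length bs}. a (bs ! i) \<odot>\<^bsub>V\<^esub> bs ! i)"
    using inj a bs_closed by (intro M.add.finprod_reindex) (auto simp: Pi_iff)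
  also have "\<dots> = (\<Oplus>\<^bsub>V\<^esub>i\<in>{..<length bs}. d i \<odot>\<^bsub>V\<^esub> bs ! i)"
    using bs_closed assms(3) a_nth by (intro M.finsum_cong') auto
  finally show "lincomb a (set bs) = (\<Oplus>\<^bsub>V\<^esub>i\<in>{..<length bs}. d i \<odot>\<^bsub>V\<^esub> bs ! i)" .
qed

lemma basis_list_independent:
  assumes "distinct bs" "basis (set bs)" "\<And>i. i < length bs \<Longrightarrow> d i \<in> carrier K"
    and "(\<Oplus>\<^bsub>V\<^esub>i\<in>{..<length bs}. d i \<odot>\<^bsub>V\<^esub> bs ! i) = \<zero>\<^bsub>V\<^esub>" "i < length bs"
  shows "d i = \<zero>\<^bsub>K\<^esub>"
proof -
  have "set bs \<subseteq> carrier V" "lin_indpt (set bs)" using assms(2) by (simp_all add: basis_def)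
  from assms(1) this(1) assms(3)
  obtain a where a: "a \<in> set bs \<rightarrow> carrier K" "\<And>i. i < length bs \<Longrightarrow> a (bs ! i) = d i"
    "lincomb a (set bs) = (\<Oplus>\<^bsub>V\<^esub>i\<in>{..<length bs}. d i \<odot>\<^bsub>V\<^esub> bs ! i)"
    using lincomb_list[of bs d] by blast
  have "a v = \<zero>\<^bsub>K\<^esub>" if "v \<in> set bs" for v
    using \<open>lin_indpt (set bs)\<close> lin_dep_crit[OF finite_set subset_refl a(1) that] a(3) assms(4) by metis
  then show ?thesis using a(2)[OF assms(5)] assms(5) by (metis nth_mem)
qed

lemma spanning_list:
  assumes "set bs \<subseteq> carrier V" "span (set bs) = carrier V" "distinct bs" "v \<in> carrier V"
  shows "\<exists>d. (\<forall>i<length bs. d i \<in> carrier K) \<and> v = (\<Oplus>\<^bsub>V\<^esub>i\<in>{..<length bs}. d i \<odot>\<^bsub>V\<^esub> bs ! i)"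
proof -
  obtain a where a: "a \<in> set bs \<rightarrow> carrier K" "v = lincomb a (set bs)"
    using finite_in_span[OF finite_set assms(1), of v] assms(2,4) by auto
  have d: "a (bs ! i) \<in> carrier K" if "i < length bs" for i using a(1) that by (auto simp: Pi_iff)
  from assms(3,1) d obtain a' where a': "a' \<in> set bs \<rightarrow> carrier K"
    "\<And>i. i < length bs \<Longrightarrow> a' (bs ! i) = a (bs ! i)"
    "lincomb a' (set bs) = (\<Oplus>\<^bsub>V\<^esub>i\<in>{..<length bs}. a (bs ! i) \<odot>\<^bsub>V\<^esub> bs ! i)"
    using lincomb_list[of bs "\<lambda>i. a (bs ! i)"] by blast
  have "lincomb a (set bs) = lincomb a' (set bs)"
    using a(1) a'(1,2) assms(1) by (intro lincomb_cong) (auto simp: in_set_conv_nth)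
  then show ?thesis using a(2) a'(3) d by (intro exI[of _ "\<lambda>i. a (bs ! i)"]) simp
qed

end

lemma algebra_vectorspace:
  "algebra (class_ring :: 'k::field ring) A \<Longrightarrow> vectorspace (class_ring :: 'k ring) A"
  by (simp add: vectorspace_def algebra.module class_field)

text \<open>The equation says \<open>(a - c)\<^sup>2 = 0\<close>. It passes to the matrix of multiplication by \<open>a\<close> with respect to every
basis, so the result holds for whichever basis the choice operator picks.\<close>

lemma mult_char_poly_square_zero_shift:
  fixes A :: "('k::field, 'a) module" (structure)
  assumes alg: "algebra class_ring A" and fd: "vectorspace.fin_dim class_ring A"
    and a: "a \<in> carrier A"
    and sq: "a \<otimes> a \<oplus> c\<^sup>2 \<odot> \<one> = (2 * c) \<odot> a"
  shows "mult_char_poly A a = [:- c, 1:] ^ vectorspace.dim class_ring A"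
proof -
  interpret algebra "class_ring :: 'k ring" A by fact
  interpret V: vectorspace "class_ring :: 'k ring" A by (rule algebra_vectorspace[OF alg])
  define Q where "Q p \<longleftrightarrow> (\<exists>bs M. distinct bs \<and> V.basis (set bs) \<and>
        M \<in> carrier_mat (length bs) (length bs) \<and>
        (\<forall>j<length bs. a \<otimes> bs ! j = (\<Oplus>i\<in>{..<length bs}. M $$ (i, j) \<odot> bs ! i)) \<and>
        p = char_poly M)" for p
  \<comment> \<open>some basis and matrix exist, so that the choice operator has something to choose\<close>
  have "\<exists>p. Q p"
  proof -
    obtain \<beta> where \<beta>: "finite \<beta>" "V.basis \<beta>" using V.finite_basis_exists[OF fd] by blast
    obtain bs where bs: "set bs = \<beta>" "distinct bs" using finite_distinct_list[OF \<beta>(1)] by blast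
    have sub: "set bs \<subseteq> carrier A" using \<beta>(2) bs(1) by (simp add: V.basis_def)
    note gen = conjunct1[OF conjunct2[OF \<beta>(2)[folded bs(1), unfolded V.basis_def]]]
    have "\<exists>d. a \<otimes> bs ! j = (\<Oplus>i\<in>{..<length bs}. d i \<odot> bs ! i)" if "j < length bs" for j
      using V.spanning_list[OF sub gen bs(2), of "a \<otimes> bs ! j"] a sub that nth_mem[OF that] by blast
    then obtain d where d: "\<And>j. j < length bs \<Longrightarrow> a \<otimes> bs ! j = (\<Oplus>i\<in>{..<length bs}. d j i \<odot> bs ! i)"
      by metis
    define M where "M = mat (length bs) (length bs) (\<lambda>(i, j). d j i)"
    have "a \<otimes> bs ! j = (\<Oplus>i\<in>{..<length bs}. M $$ (i, j) \<odot> bs ! i)" if j: "j < length bs" for j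
      unfolding d[OF j] using j subsetD[OF sub nth_mem] by (intro M.finsum_cong') (auto simp: M_def)
    then have "Q (char_poly M)"
      unfolding Q_def using bs \<beta>(2) by (intro exI[of _ bs] exI[of _ M]) (auto simp: M_def)
    then show ?thesis by blast
  qed
  then have "Q (mult_char_poly A a)"
    unfolding mult_char_poly_def Q_def[symmetric] by (rule someI_ex)
  then obtain bs M where bs: "distinct bs" "V.basis (set bs)"
    and M: "M \<in> carrier_mat (length bs) (length bs)"
    and mult: "\<And>j. j < length bs \<Longrightarrow> a \<otimes> bs ! j = (\<Oplus>i\<in>{..<length bs}. M $$ (i, j) \<odot> bs ! i)"
    and p: "mult_char_poly A a = char_poly M"
    unfolding Q_def by blast
  let ?n = "length bs"
  have n: "V.dim = ?n" using V.dim_basis[OF finite_set bs(2)] distinct_card[OF bs(1)] by simp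
  have bsA: "bs ! i \<in> carrier A" if "i < ?n" for i
    using bs(2) nth_mem[OF that] by (auto simp: V.basis_def)
  define comb where "comb d = (\<Oplus>i\<in>{..<?n}. d i \<odot> bs ! i)" for d
  have comb_closed: "comb d \<in> carrier A" for d
    unfolding comb_def using bsA by (intro M.finsum_closed) auto
  have comb_add: "comb (\<lambda>i. d i + e i) = comb d \<oplus> comb e" for d e
  proof -
    have "comb (\<lambda>i. d i + e i) = (\<Oplus>i\<in>{..<?n}. d i \<odot> bs ! i \<oplus> e i \<odot> bs ! i)"
      unfolding comb_def using bsA smult_l_distr by (intro M.finsum_cong') auto
    also have "\<dots> = comb d \<oplus> comb e"
      unfolding comb_def using bsA by (intro M.finsum_addf) auto
    finally show ?thesis .
  qed
  have comb_smult: "comb (\<lambda>i. s * d i) = s \<odot> comb d" for s d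
  proof -
    have "comb (\<lambda>i. s * d i) = (\<Oplus>i\<in>{..<?n}. s \<odot> (d i \<odot> bs ! i))"
      unfolding comb_def using bsA smult_assoc1 by (intro M.finsum_cong') auto
    also have "\<dots> = s \<odot> comb d"
      unfolding comb_def using bsA by (intro finsum_smult_ldistr[symmetric]) auto
    finally show ?thesis .
  qed
  have comb_zero: "comb (\<lambda>i. 0) = \<zero>"
    using comb_smult[of 0 "\<lambda>i. 0"] comb_closed smult_l_null by simp
  have comb_sum: "comb (\<lambda>i. \<Sum>l\<in>S. d l i) = (\<Oplus>l\<in>S. comb (d l))" if "finite S" for S :: "nat set" and d
    using that by (induction S) (simp_all add: comb_zero comb_add comb_closed)
  have comb_mult: "a \<otimes> comb d = comb (\<lambda>i. \<Sum>l<?n. d l * M $$ (i, l))" for d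
  proof -
    have "a \<otimes> comb d = (\<Oplus>l\<in>{..<?n}. a \<otimes> (d l \<odot> bs ! l))"
      unfolding comb_def using bsA a by (intro finsum_rdistr) auto
    also have "\<dots> = (\<Oplus>l\<in>{..<?n}. comb (\<lambda>i. d l * M $$ (i, l)))"
    proof (rule M.finsum_cong')
      fix l assume "l \<in> {..<?n}"
      then have l: "l < ?n" by simp
      have "a \<otimes> (d l \<odot> bs ! l) = d l \<odot> (a \<otimes> bs ! l)"
        using a bsA[OF l] smult_assoc2[of "d l" "bs ! l" a] by (simp add: m_comm)
      also have "\<dots> = comb (\<lambda>i. d l * M $$ (i, l))"
        unfolding mult[OF l] comb_smult by (simp add: comb_def)
      finally show "a \<otimes> (d l \<odot> bs ! l) = comb (\<lambda>i. d l * M $$ (i, l))" .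
    qed (use comb_closed in auto)
    also have "\<dots> = comb (\<lambda>i. \<Sum>l<?n. d l * M $$ (i, l))" by (rule comb_sum[symmetric]) simp
    finally show ?thesis .
  qed
  have unit: "comb (\<lambda>i. if i = j then 1 else 0) = bs ! j" if j: "j < ?n" for j
  proof -
    have "comb (\<lambda>i. if i = j then 1 else 0) = (\<Oplus>i\<in>{..<?n}. if j = i then bs ! i else \<zero>)"
      unfolding comb_def using bsA smult_one smult_l_null by (intro M.finsum_cong') auto
    also have "\<dots> = bs ! j" using j bsA by (intro M.finsum_singleton) auto
    finally show ?thesis .
  qed
  have "(\<Sum>l<?n. M $$ (i, l) * M $$ (l, j)) = 2 * c * M $$ (i, j) - (if i = j then c\<^sup>2 else 0)"
    if i: "i < ?n" and j: "j < ?n" for i j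
  proof -
    let ?v = "bs ! j"
    define d where "d i = (\<Sum>l<?n. M $$ (l, j) * M $$ (i, l)) + c\<^sup>2 * (if i = j then 1 else 0)
      + (- (2 * c)) * M $$ (i, j)" for i
    have av: "a \<otimes> ?v = comb (\<lambda>i. M $$ (i, j))" unfolding mult[OF j] by (simp add: comb_def)
    have "comb d = a \<otimes> (a \<otimes> ?v) \<oplus> c\<^sup>2 \<odot> ?v \<oplus> (- (2 * c)) \<odot> (a \<otimes> ?v)"
      unfolding d_def comb_add comb_smult unit[OF j] av comb_mult ..
    also have "a \<otimes> (a \<otimes> ?v) \<oplus> c\<^sup>2 \<odot> ?v = (a \<otimes> a \<oplus> c\<^sup>2 \<odot> \<one>) \<otimes> ?v"
      using a bsA[OF j] smult_assoc2[of "c\<^sup>2" \<one> ?v] by (simp add: l_distr m_assoc)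
    also have "\<dots> = (2 * c) \<odot> (a \<otimes> ?v)"
      unfolding sq using a bsA[OF j] smult_assoc2 by simp
    also have "\<dots> \<oplus> (- (2 * c)) \<odot> (a \<otimes> ?v) = (2 * c + - (2 * c)) \<odot> (a \<otimes> ?v)"
      using a bsA[OF j] smult_l_distr[of "2 * c" "- (2 * c)" "a \<otimes> ?v"] by simp
    also have "\<dots> = \<zero>" using a bsA[OF j] smult_l_null by simp
    finally have "d i = 0"
      using V.basis_list_independent[OF bs, of d i] i by (simp add: comb_def)
    then show ?thesis by (simp add: d_def mult.commute algebra_simps split: if_splits)
  qed
  from char_poly_square_zero_shift[OF M this] show ?thesis by (simp add: p n)
qed

section \<open>The quotient of the polynomial ring by the squared variable ideal\<close>

text \<open>The coefficient of \<open>1\<close> for \<open>k = 0\<close>, and of the variable \<open>x\<^sub>k\<close> otherwise.\<close>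

definition low_coeff :: "((nat \<Rightarrow>\<^sub>0 nat) \<Rightarrow>\<^sub>0 'k::field) \<Rightarrow> nat \<Rightarrow> 'k" where
  "low_coeff p k = Poly_Mapping.lookup p (if k = 0 then 0 else Poly_Mapping.single k 1)"

lemma low_coeff_linear:
  "low_coeff (p + q) k = low_coeff p k + low_coeff q k"
  "low_coeff (p - q) k = low_coeff p k - low_coeff q k"
  "low_coeff (scale c p) k = c * low_coeff p k"
  "low_coeff 0 k = 0"
  "low_coeff (sum f S) k = (\<Sum>x\<in>S. low_coeff (f x) k)"
  by (simp_all add: low_coeff_def lookup_add lookup_minus lookup_sum)

lemma exponent_eq_0_iff: "a + b = 0 \<longleftrightarrow> a = 0 \<and> b = (0 :: nat \<Rightarrow>\<^sub>0 nat)"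
  by (auto simp: poly_mapping_eq_iff fun_eq_iff lookup_add)

lemma exponent_eq_single_iff:
  "a + b = Poly_Mapping.single i (Suc 0) \<longleftrightarrow>
    a = 0 \<and> b = Poly_Mapping.single i (Suc 0) \<or> b = 0 \<and> a = Poly_Mapping.single i (Suc 0)"
proof
  assume eq: "a + b = Poly_Mapping.single i (Suc 0)"
  have sum: "Poly_Mapping.lookup a j + Poly_Mapping.lookup b j = (if i = j then Suc 0 else 0)" for j
    using arg_cong[OF eq, of "\<lambda>p. Poly_Mapping.lookup p j"] by (simp add: lookup_add lookup_single when_def)
  show "a = 0 \<and> b = Poly_Mapping.single i (Suc 0) \<or> b = 0 \<and> a = Poly_Mapping.single i (Suc 0)"
  proof (cases "Poly_Mapping.lookup a i = 0")
    case True
    then have "Poly_Mapping.lookup a j = 0" for j using sum[of j] by (cases "i = j") auto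
    then have "a = 0" by (intro poly_mapping_eqI) simp
    then show ?thesis using eq by simp
  next
    case False
    then have "Poly_Mapping.lookup b j = 0" for j using sum[of j] by (cases "i = j") auto
    then have "b = 0" by (intro poly_mapping_eqI) simp
    then show ?thesis using eq by simp
  qed
qed auto

lemma single_Suc_0_neq_0 [simp]: "Poly_Mapping.single k (Suc 0) \<noteq> 0"
  by (metis lookup_single_eq lookup_zero nat.simps(3))

lemma low_coeff_mult:
  "low_coeff (p * q) k =
    (if k = 0 then low_coeff p 0 * low_coeff q 0
     else low_coeff p 0 * low_coeff q k + low_coeff p k * low_coeff q 0)"
proof -
  have "Poly_Mapping.keys p \<subseteq> UNIV" by simp
  then show ?thesis
  proof (induction p rule: poly_mapping_span_induct)
    case (single u a)
    have "Poly_Mapping.keys q \<subseteq> UNIV" by simp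
    then show ?case
    proof (induction q rule: poly_mapping_span_induct)
      case (single v b)
      show ?case
        by (auto simp: low_coeff_def mult_single lookup_single when_def exponent_eq_0_iff
            exponent_eq_single_iff)
    qed (simp_all add: low_coeff_linear algebra_simps)
  qed (simp_all add: low_coeff_linear algebra_simps)
qed

lemma polynomial_algebra_sel [simp]:
  "carrier (polynomial_algebra n) = {p. \<forall>m\<in>Poly_Mapping.keys p. Poly_Mapping.keys m \<subseteq> {1..<n}}"
  "monoid.mult (polynomial_algebra n) = (*)"
  "\<one>\<^bsub>polynomial_algebra n\<^esub> = 1"
  "\<zero>\<^bsub>polynomial_algebra n\<^esub> = 0"
  "add (polynomial_algebra n) = (+)"
  "module.smult (polynomial_algebra n) = scale"
  by (simp_all add: polynomial_algebra_def scale_def fun_eq_iff)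

lemma polynomial_carrier_iff:
  "p \<in> carrier (polynomial_algebra n) \<longleftrightarrow>
    Poly_Mapping.keys p \<subseteq> {m. Poly_Mapping.keys m \<subseteq> {1..<n}}"
  by auto

lemma scale_mult: "scale c p * q = scale c (p * (q :: (nat \<Rightarrow>\<^sub>0 nat) \<Rightarrow>\<^sub>0 'k::field))"
  by (simp add: scale_def mult_map_scale_conv_mult mult.assoc)

lemma algebra_polynomial_algebra:
  "algebra class_ring (polynomial_algebra n :: ('k::field, _) module)"
proof (rule algebraI)
  let ?P = "polynomial_algebra n :: ('k, _) module"
  note del = polynomial_algebra_sel(1)
  note iff = polynomial_carrier_iff
  have mult: "p * q \<in> carrier ?P" if "p \<in> carrier ?P" "q \<in> carrier ?P" for p q
  proof -
    have "Poly_Mapping.keys (u + v) \<subseteq> {1..<n}" if "u \<in> Poly_Mapping.keys p" "v \<in> Poly_Mapping.keys q" for u v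
      using keys_add[of u v] that \<open>p \<in> carrier ?P\<close> \<open>q \<in> carrier ?P\<close> by fastforce
    then show ?thesis using keys_mult[of p q] by fastforce
  qed
  show "cring (class_ring :: 'k ring)" by (rule class_cring.cring_axioms)
  show "cring ?P"
  proof (rule cringI)
    show "abelian_group ?P"
    proof (rule abelian_groupI)
      fix p assume "p \<in> carrier ?P"
      then show "\<exists>q\<in>carrier ?P. q \<oplus>\<^bsub>?P\<^esub> p = \<zero>\<^bsub>?P\<^esub>" by (intro bexI[of _ "- p"]) (auto simp: iff simp del: del)
    qed (simp_all add: iff keys_add_subset ac_simps del: del)
    show "comm_monoid ?P"
      by (rule comm_monoidI) (simp_all add: mult ac_simps del: del, simp)
  qed (simp add: distrib_right)
qed (simp_all add: polynomial_carrier_iff keys_scale_subset scale_mult pm.scale_left_distrib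
      pm.scale_right_distrib del: polynomial_algebra_sel(1))

definition variable :: "nat \<Rightarrow> (nat \<Rightarrow>\<^sub>0 nat) \<Rightarrow>\<^sub>0 'k::field" where
  "variable i = Poly_Mapping.single (Poly_Mapping.single i 1) 1"

definition low_monomial :: "nat \<Rightarrow> (nat \<Rightarrow>\<^sub>0 nat) \<Rightarrow>\<^sub>0 'k::field" where
  "low_monomial k = (if k = 0 then 1 else variable k)"

lemma low_coeff_low_monomial: "low_coeff (low_monomial j) k = (if j = k then 1 else 0)"
  by (auto simp: low_coeff_def low_monomial_def variable_def lookup_single lookup_one when_def
      inj_eq[OF inj_single] dest: arg_cong[where f = Poly_Mapping.keys])

text \<open>The argument \<open>ty\<close> fixes the base field, on which the number \<open>n\<close> of the other parameter does not depend.\<close>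

locale square_zero_algebra =
  fixes n :: nat and ty :: "'k::field itself"
  assumes n_pos: "1 \<le> n"
begin

abbreviation P :: "('k, (nat \<Rightarrow>\<^sub>0 nat) \<Rightarrow>\<^sub>0 'k) module" where "P \<equiv> polynomial_algebra n"
abbreviation V :: "((nat \<Rightarrow>\<^sub>0 nat) \<Rightarrow>\<^sub>0 'k) set" where "V \<equiv> variable_ideal n"
abbreviation V2 :: "((nat \<Rightarrow>\<^sub>0 nat) \<Rightarrow>\<^sub>0 'k) set" where "V2 \<equiv> ideal_prod P V V"
abbreviation R :: "('k, ((nat \<Rightarrow>\<^sub>0 nat) \<Rightarrow>\<^sub>0 'k) set) module" where "R \<equiv> R_alg n"

sublocale P: algebra "class_ring :: 'k ring" P
  by (rule algebra_polynomial_algebra)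

lemma variable_closed: "i \<in> {1..<n} \<Longrightarrow> variable i \<in> carrier P"
  by (simp add: variable_def)

lemma low_monomial_closed: "k < n \<Longrightarrow> low_monomial k \<in> carrier P"
  using variable_closed[of k] by (auto simp: low_monomial_def)

lemma variables_closed:
  "(\<lambda>i. Poly_Mapping.single (Poly_Mapping.single i 1) 1) ` {1..<n} \<subseteq> carrier P"
  using variable_closed unfolding variable_def by blast

lemma ideal_V: "ideal V P"
  unfolding variable_ideal_def by (rule P.genideal_ideal[OF variables_closed])

lemma ideal_V2: "ideal V2 P"
  by (rule P.ideal_prod_is_ideal[OF ideal_V ideal_V])

lemma variable_in_V: "i \<in> {1..<n} \<Longrightarrow> variable i \<in> V"
  using P.genideal_self[OF variables_closed] unfolding variable_ideal_def variable_def by blast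

lemma V_low_coeff: "p \<in> V \<Longrightarrow> low_coeff p 0 = 0"
proof -
  let ?L = "{p \<in> carrier P. low_coeff p 0 = 0}"
  have "ideal ?L P"
  proof (rule ideal_by_subtraction[OF P.M_cring])
    fix p q assume "p \<in> ?L" "q \<in> ?L"
    then show "p - q \<in> ?L"
      using P.M.add.m_closed[of p "scale (- 1) q"] P.smult_closed[of "- 1" q]
      by (simp add: low_coeff_linear del: polynomial_algebra_sel(1))
  next
    fix p q assume "q \<in> carrier P" "p \<in> ?L"
    then show "q \<otimes>\<^bsub>P\<^esub> p \<in> ?L"
      using P.m_closed[of q p] by (simp add: low_coeff_mult del: polynomial_algebra_sel(1))
  qed (auto simp: low_coeff_linear)
  moreover have "(\<lambda>i. Poly_Mapping.single (Poly_Mapping.single i 1) 1) ` {1..<n} \<subseteq> ?L"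
    using variables_closed by (auto simp: low_coeff_def lookup_single)
  ultimately have "V \<subseteq> ?L" unfolding variable_ideal_def by (rule P.genideal_minimal)
  then show "p \<in> V \<Longrightarrow> low_coeff p 0 = 0" by blast
qed

lemma V2_low_coeff: "p \<in> V2 \<Longrightarrow> low_coeff p k = 0"
  by (induction rule: ideal_prod.induct) (simp_all add: low_coeff_mult low_coeff_linear V_low_coeff)

lemma exponent_split:
  assumes "u \<noteq> (0 :: nat \<Rightarrow>\<^sub>0 nat)"
  obtains i u' where "i \<in> Poly_Mapping.keys u" "Poly_Mapping.keys u' \<subseteq> Poly_Mapping.keys u"
    "u = Poly_Mapping.single i 1 + u'"
proof -
  obtain i where i: "i \<in> Poly_Mapping.keys u" using assms by (metis all_not_in_conv keys_eq_empty)
  have "u = Poly_Mapping.single i 1 + (u - Poly_Mapping.single i 1)"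
    using i by (intro poly_mapping_eqI) (auto simp: lookup_add lookup_minus lookup_single when_def in_keys_iff)
  moreover have "Poly_Mapping.keys (u - Poly_Mapping.single i 1) \<subseteq> Poly_Mapping.keys u"
    by (auto simp: in_keys_iff lookup_minus)
  ultimately show thesis using that i by blast
qed

text \<open>A monomial different from \<open>1\<close> and from the variables is divisible by a product of two variables.\<close>

lemma V2_iff:
  assumes p: "p \<in> carrier P"
  shows "p \<in> V2 \<longleftrightarrow> (\<forall>k<n. low_coeff p k = 0)"
proof
  interpret V2: ideal V2 P by (rule ideal_V2)
  interpret V: ideal V P by (rule ideal_V)
  assume low: "\<forall>k<n. low_coeff p k = 0"
  have monomial: "Poly_Mapping.single u c \<in> V2" if u: "u \<in> Poly_Mapping.keys p" for u and c :: 'k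
  proof -
    have keys: "Poly_Mapping.keys u \<subseteq> {1..<n}" using p u by simp
    have u0: "u \<noteq> 0" using u low n_pos by (auto simp: low_coeff_def in_keys_iff)
    obtain i u' where i: "i \<in> Poly_Mapping.keys u" "Poly_Mapping.keys u' \<subseteq> Poly_Mapping.keys u"
      and u_eq: "u = Poly_Mapping.single i 1 + u'" using exponent_split[OF u0] by blast
    have i': "i \<in> {1..<n}" using keys i(1) by blast
    have "u' \<noteq> 0"
    proof
      assume "u' = 0"
      then have "low_coeff p i \<noteq> 0" using u i' u_eq by (auto simp: low_coeff_def in_keys_iff)
      then show False using low i' by simp
    qed
    then obtain j u'' where j: "j \<in> Poly_Mapping.keys u'" "Poly_Mapping.keys u'' \<subseteq> Poly_Mapping.keys u'"
      and u'_eq: "u' = Poly_Mapping.single j 1 + u''" using exponent_split by blast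
    have j': "j \<in> {1..<n}" using keys i(2) j(1) by blast
    have "Poly_Mapping.single u'' c \<in> carrier P" using keys i(2) j(2) by auto
    then have "variable j \<otimes>\<^bsub>P\<^esub> Poly_Mapping.single u'' c \<in> V"
      by (rule V.I_r_closed[OF variable_in_V[OF j']])
    from ideal_prod.prod[OF variable_in_V[OF i'] this, of P]
    show ?thesis by (simp add: variable_def mult_single u_eq u'_eq add.assoc)
  qed
  have "(\<Sum>u\<in>U. Poly_Mapping.single u (Poly_Mapping.lookup p u)) \<in> V2"
    if "finite U" "U \<subseteq> Poly_Mapping.keys p" for U
    using that
    by (induction U) (use V2.zero_closed V2.a_closed monomial in \<open>auto\<close>)
  from this[of "Poly_Mapping.keys p"] show "p \<in> V2"
    using poly_mapping_eq_sum_singles[of p] by simp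
qed (simp add: V2_low_coeff)

sublocale quot: algebra_epi "class_ring :: 'k ring" P R "(+>\<^bsub>P\<^esub>) V2"
  unfolding R_alg_def by (rule quot_algebra_epi[OF P.algebra_axioms ideal_V2])

text \<open>By \<open>V2_iff\<close> the coefficients of \<open>1\<close> and of the variables are the same for all representatives of a coset.\<close>

definition coord :: "((nat \<Rightarrow>\<^sub>0 nat) \<Rightarrow>\<^sub>0 'k) set \<Rightarrow> nat \<Rightarrow> 'k" where
  "coord X = low_coeff (SOME p. p \<in> carrier P \<and> X = V2 +>\<^bsub>P\<^esub> p)"

lemma coord_coset:
  assumes p: "p \<in> carrier P"
  shows "coord (V2 +>\<^bsub>P\<^esub> p) k = low_coeff p k"
proof -
  interpret V2: ideal V2 P by (rule ideal_V2)
  define q where "q = (SOME q. q \<in> carrier P \<and> V2 +>\<^bsub>P\<^esub> p = V2 +>\<^bsub>P\<^esub> q)"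
  have q: "q \<in> carrier P \<and> V2 +>\<^bsub>P\<^esub> p = V2 +>\<^bsub>P\<^esub> q"
    unfolding q_def by (rule someI[of _ p]) (simp add: p del: polynomial_algebra_sel)
  have "p \<in> V2 +>\<^bsub>P\<^esub> q" using V2.a_rcos_self[OF p] q by simp
  then obtain v where "v \<in> V2" "p = v + q" by (auto simp: a_r_coset_def')
  then have "low_coeff p k = low_coeff q k" by (simp add: low_coeff_linear V2_low_coeff)
  then show ?thesis by (simp add: coord_def q_def)
qed

definition gen :: "nat \<Rightarrow> ((nat \<Rightarrow>\<^sub>0 nat) \<Rightarrow>\<^sub>0 'k) set" where
  "gen k = V2 +>\<^bsub>P\<^esub> low_monomial k"

lemma gen_closed: "k < n \<Longrightarrow> gen k \<in> carrier R"
  unfolding gen_def by (rule quot.h_closed[OF low_monomial_closed])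

lemma gen_0: "gen 0 = \<one>\<^bsub>R\<^esub>"
  using quot.h_one by (simp add: gen_def low_monomial_def)

lemma coord_gen: "j < n \<Longrightarrow> coord (gen j) k = (if j = k then 1 else 0)"
  unfolding gen_def coord_coset[OF low_monomial_closed] low_coeff_low_monomial ..

lemma coord_add:
  assumes "r \<in> carrier R" "s \<in> carrier R"
  shows "coord (r \<oplus>\<^bsub>R\<^esub> s) k = coord r k + coord s k"
proof -
  obtain p q where p: "p \<in> carrier P" "r = V2 +>\<^bsub>P\<^esub> p" and q: "q \<in> carrier P" "s = V2 +>\<^bsub>P\<^esub> q"
    using assms quot.preimage by metis
  have "r \<oplus>\<^bsub>R\<^esub> s = V2 +>\<^bsub>P\<^esub> (p + q)" "p + q \<in> carrier P"
    using quot.h_add[OF p(1) q(1)] P.M.add.m_closed[OF p(1) q(1)] p(2) q(2) by simp_all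
  then show ?thesis
    using coord_coset p q by (simp add: low_coeff_linear del: polynomial_algebra_sel)
qed

lemma coord_smult:
  assumes "r \<in> carrier R"
  shows "coord (c \<odot>\<^bsub>R\<^esub> r) k = c * coord r k"
proof -
  obtain p where p: "p \<in> carrier P" "r = V2 +>\<^bsub>P\<^esub> p" using assms quot.preimage by metis
  have "c \<odot>\<^bsub>R\<^esub> r = V2 +>\<^bsub>P\<^esub> (scale c p)" "scale c p \<in> carrier P"
    using quot.h_smult[of c, OF _ p(1)] P.smult_closed[of c, OF _ p(1)] p(2) by simp_all
  then show ?thesis
    using coord_coset p by (simp add: low_coeff_linear del: polynomial_algebra_sel)
qed

lemma coord_mult:
  assumes "r \<in> carrier R" "s \<in> carrier R"
  shows "coord (r \<otimes>\<^bsub>R\<^esub> s) k =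
    (if k = 0 then coord r 0 * coord s 0 else coord r 0 * coord s k + coord r k * coord s 0)"
proof -
  obtain p q where p: "p \<in> carrier P" "r = V2 +>\<^bsub>P\<^esub> p" and q: "q \<in> carrier P" "s = V2 +>\<^bsub>P\<^esub> q"
    using assms quot.preimage by metis
  have "r \<otimes>\<^bsub>R\<^esub> s = V2 +>\<^bsub>P\<^esub> (p * q)" "p * q \<in> carrier P"
    using quot.h_mult[OF p(1) q(1)] P.m_closed[OF p(1) q(1)] p(2) q(2) by simp_all
  then show ?thesis
    using coord_coset p q by (simp add: low_coeff_mult del: polynomial_algebra_sel)
qed

lemma coord_inject:
  assumes "r \<in> carrier R" "s \<in> carrier R" "\<And>k. k < n \<Longrightarrow> coord r k = coord s k"
  shows "r = s"
proof -
  interpret V2: ideal V2 P by (rule ideal_V2)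
  obtain p q where p: "p \<in> carrier P" "r = V2 +>\<^bsub>P\<^esub> p" and q: "q \<in> carrier P" "s = V2 +>\<^bsub>P\<^esub> q"
    using assms(1,2) quot.preimage by metis
  have scale_q: "scale (- 1) q \<in> carrier P" using P.smult_closed[of "- 1", OF _ q(1)] by simp
  have d: "p - q \<in> carrier P" using P.M.add.m_closed[OF p(1) scale_q] by simp
  have "p - q \<in> V2"
    unfolding V2_iff[OF d] using assms(3) p q by (simp add: low_coeff_linear coord_coset del: polynomial_algebra_sel)
  then have "p \<in> V2 +>\<^bsub>P\<^esub> q" by (auto simp: a_r_coset_def' intro!: bexI[of _ "p - q"])
  then show ?thesis unfolding p(2) q(2)
    by (rule P.a_repr_independence[OF _ _ V2.a_subgroup, symmetric]) (rule q(1))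
qed

lemma coord_comb:
  assumes "finite S" "S \<subseteq> {..<n}"
  shows "(\<Oplus>\<^bsub>R\<^esub>j\<in>S. d j \<odot>\<^bsub>R\<^esub> gen j) \<in> carrier R \<and>
    coord (\<Oplus>\<^bsub>R\<^esub>j\<in>S. d j \<odot>\<^bsub>R\<^esub> gen j) k = (if k \<in> S then d k else 0)"
  using assms
proof (induction S)
  case empty
  have "coord \<zero>\<^bsub>R\<^esub> k = 0" using coord_smult[of "\<zero>\<^bsub>R\<^esub>" 0 k] quot.cod.smult_l_null by simp
  then show ?case by simp
next
  case (insert j S)
  have j: "d j \<odot>\<^bsub>R\<^esub> gen j \<in> carrier R" using insert.prems gen_closed by simp
  have "(\<lambda>j. d j \<odot>\<^bsub>R\<^esub> gen j) \<in> S \<rightarrow> carrier R" using insert.prems gen_closed by auto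
  then have eq: "(\<Oplus>\<^bsub>R\<^esub>j\<in>insert j S. d j \<odot>\<^bsub>R\<^esub> gen j) = d j \<odot>\<^bsub>R\<^esub> gen j \<oplus>\<^bsub>R\<^esub> (\<Oplus>\<^bsub>R\<^esub>j\<in>S. d j \<odot>\<^bsub>R\<^esub> gen j)"
    using insert.hyps j by (intro quot.cod.M.finsum_insert) auto
  show ?case
    unfolding eq using insert j gen_closed[of j]
    by (auto simp: coord_add coord_smult coord_gen)
qed

lemma coord_expansion: "r \<in> carrier R \<Longrightarrow> r = (\<Oplus>\<^bsub>R\<^esub>k\<in>{..<n}. coord r k \<odot>\<^bsub>R\<^esub> gen k)"
  using coord_comb[of "{..<n}" "coord r"] by (intro coord_inject) auto

lemma coord_mult_join:
  assumes "r \<in> carrier R" "s \<in> carrier R" "k < n"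
  shows "coord (r \<otimes>\<^bsub>R\<^esub> s) k =
    (\<Sum>i<n. \<Sum>j<n. coord r i * coord s j * join_coeff i j k)"
proof -
  have "(\<Sum>j<n. coord r i * coord s j * join_coeff i j k) =
      (if i = 0 then coord r 0 * coord s k else if i = k then coord r k * coord s 0 else 0)" for i
  proof -
    have "(\<Sum>j<n. coord r i * coord s j * join_coeff i j k) =
      (\<Sum>j<n. if j = (if i = 0 then k else 0) then
        (if i = 0 \<or> i = k then coord r i * coord s j else 0) else 0)"
      by (intro sum.cong refl) (auto simp: join_coeff_def)
    then show ?thesis using assms(3) by auto
  qed
  then have "(\<Sum>i<n. \<Sum>j<n. coord r i * coord s j * join_coeff i j k) =
     (\<Sum>i<n. (if i = 0 then coord r 0 * coord s k else 0) + (if i = k then if k = 0 then 0 else coord r k * coord s 0 else 0))"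
    by (intro sum.cong refl) auto
  also have "\<dots> = coord (r \<otimes>\<^bsub>R\<^esub> s) k"
    unfolding coord_mult[OF assms(1,2)] sum.distrib using assms(3) n_pos by simp
  finally show ?thesis ..
qed

sublocale VR: vectorspace "class_ring :: 'k ring" R
  by (rule algebra_vectorspace[OF quot.codomain_algebra])

lemma gen_basis: "VR.basis (gen ` {..<n})"
proof -
  let ?B = "gen ` {..<n}"
  have sub: "?B \<subseteq> carrier R" using gen_closed by auto
  have inj: "inj_on gen {..<n}"
    by (rule inj_onI) (metis coord_gen lessThan_iff zero_neq_one)
  have lincomb: "quot.cod.lincomb a ?B = (\<Oplus>\<^bsub>R\<^esub>k\<in>{..<n}. a (gen k) \<odot>\<^bsub>R\<^esub> gen k)" for a
    unfolding quot.cod.lincomb_def using inj gen_closed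
    by (intro quot.cod.M.add.finprod_reindex) auto
  show ?thesis
    unfolding VR.basis_def
  proof (intro conjI sub)
    show "\<not> quot.cod.lin_dep ?B"
    proof (rule quot.cod.finite_lin_indpt2[OF _ sub])
      fix a assume "quot.cod.lincomb a ?B = \<zero>\<^bsub>R\<^esub>"
      then have "coord (\<Oplus>\<^bsub>R\<^esub>j\<in>{..<n}. a (gen j) \<odot>\<^bsub>R\<^esub> gen j) k = 0" for k
        using coord_smult[of "\<zero>\<^bsub>R\<^esub>" 0 k] quot.cod.smult_l_null by (simp add: lincomb)
      then have "a (gen k) = 0" if "k < n" for k
        using coord_comb[of "{..<n}" "\<lambda>j. a (gen j)" k] that by simp
      then show "\<forall>v\<in>?B. a v = \<zero>\<^bsub>class_ring\<^esub>" by auto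
    qed simp
    show "quot.cod.gen_set ?B"
    proof
      show "quot.cod.span ?B \<subseteq> carrier R" by (rule quot.cod.span_is_subset2[OF sub])
      show "carrier R \<subseteq> quot.cod.span ?B"
      proof
        fix r assume r: "r \<in> carrier R"
        let ?a = "\<lambda>v. coord r (the_inv_into {..<n} gen v)"
        have "quot.cod.lincomb ?a ?B = (\<Oplus>\<^bsub>R\<^esub>k\<in>{..<n}. coord r k \<odot>\<^bsub>R\<^esub> gen k)"
          unfolding lincomb using gen_closed
          by (intro quot.cod.M.finsum_cong') (auto simp: the_inv_into_f_f[OF inj])
        then have "quot.cod.lincomb ?a ?B = r" using coord_expansion[OF r] by simp
        then show "r \<in> quot.cod.span ?B" by (auto simp: quot.cod.finite_span[OF _ sub])
      qed
    qed
  qed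
qed

lemma dim_R: "VR.dim = n" "VR.fin_dim"
proof -
  have "inj_on gen {..<n}"
    by (rule inj_onI) (metis coord_gen lessThan_iff zero_neq_one)
  then show "VR.dim = n" using VR.dim_basis[OF _ gen_basis] by (simp add: card_image)
  show "VR.fin_dim" unfolding VR.fin_dim_def using gen_basis by (intro exI[of _ "gen ` {..<n}"]) (simp add: VR.basis_def)
qed

lemma char_coeff_R:
  assumes r: "r \<in> carrier R" and j: "j \<le> n"
  shows "char_coeff R j r = of_nat (n choose j) * coord r 0 ^ j"
proof -
  let ?c = "coord r 0"
  have "r \<otimes>\<^bsub>R\<^esub> r \<oplus>\<^bsub>R\<^esub> ?c\<^sup>2 \<odot>\<^bsub>R\<^esub> \<one>\<^bsub>R\<^esub> = (2 * ?c) \<odot>\<^bsub>R\<^esub> r"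
    using r n_pos coord_gen[of 0]
    by (intro coord_inject) (auto simp: coord_add coord_mult coord_smult gen_0 power2_eq_square)
  from mult_char_poly_square_zero_shift[OF quot.codomain_algebra dim_R(2) r this]
  have "mult_char_poly R r = [:- ?c, 1:] ^ n" by (simp add: dim_R)
  moreover have "n choose (n - j) = n choose j" using j by (rule binomial_symmetric[symmetric])
  moreover have "(- 1) ^ j * (- ?c) ^ j = ?c ^ j" by (simp add: power_mult_distrib[symmetric])
  ultimately show ?thesis
    using j by (simp add: char_coeff_def dim_R coeff_linear_poly_power mult.left_commute)
qed

sublocale RP: monomial_power R n gen coord
  by unfold_locales (use n_pos in \<open>simp_all add: dim_R gen_closed gen_0 coord_expansion[symmetric]\<close>)

end

section \<open>Comparison of dimensions\<close>

context monomial_power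
begin

abbreviation G where "G \<equiv> Sn_closure A"

sublocale VG: vectorspace "class_ring :: 'k ring" G
  by (rule algebra_vectorspace[OF proj.codomain_algebra])

text \<open>All monomials together span modulo \<open>J\<close> by multilinear expansion, and by assumption those in \<open>C\<close> span the others.\<close>

lemma closure_generated:
  assumes C: "C \<subseteq> Idx" and span: "\<And>f. f \<in> Idx \<Longrightarrow> mon f \<in> monspan C"
  shows "proj.cod.gen_set ((\<lambda>f. proj (mon f)) ` C)"
proof
  let ?S = "(\<lambda>f. proj (mon f)) ` C"
  have sub: "?S \<subseteq> carrier G" using C mon_closed proj.h_closed by blast
  show "proj.cod.span ?S \<subseteq> carrier G" by (rule proj.cod.span_is_subset2[OF sub])
  interpret S: submodule "class_ring :: 'k ring" "proj.cod.span ?S" G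
    by (rule proj.cod.span_is_submodule[OF sub])
  let ?W = "{p \<in> carrier T. proj p \<in> proj.cod.span ?S}"
  have W: "monspan C \<subseteq> ?W"
  proof (rule monspan_subset)
    fix f assume "f \<in> C"
    then show "mon f \<in> ?W" using C mon_closed proj.cod.in_own_span[OF sub] by blast
  next
    show "J \<subseteq> ?W"
    proof
      fix p assume p: "p \<in> J"
      then have pT: "p \<in> carrier T" by (simp add: J_def)
      have "proj p = \<zero>\<^bsub>G\<^esub>" using p by (simp only: proj_eq_zero_iff[OF pT])
      then show "p \<in> ?W" using pT S.zero_closed by (simp only: mem_Collect_eq simp_thms)
    qed
  next
    show "pm.subspace ?W"
    proof (rule pm.subspaceI)
      show "0 \<in> ?W" using proj.h_zero S.zero_closed by simp
    next
      fix p q assume p: "p \<in> ?W" and q: "q \<in> ?W"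
      then have "proj (p + q) = proj p \<oplus>\<^bsub>G\<^esub> proj q" using proj.h_add[of p q] by simp
      then show "p + q \<in> ?W" using p q S.m_closed by (simp add: keys_add_subset)
    next
      fix c p assume p: "p \<in> ?W"
      then have "proj (scale c p) = c \<odot>\<^bsub>G\<^esub> proj p" using proj.h_smult[of c p] by simp
      then show "scale c p \<in> ?W" using p S.smult_closed[of c] by (simp add: keys_scale_subset)
    qed
  qed
  have "monspan Idx \<subseteq> monspan C"
    by (rule monspan_subset[OF span J_subset_monspan subspace_monspan])
  then have T: "carrier T \<subseteq> ?W" by (rule order.trans[OF monspan_Idx order.trans[OF _ W]])
  show "carrier G \<subseteq> proj.cod.span ?S"
  proof
    fix y assume "y \<in> carrier G"
    then obtain p where "p \<in> carrier T" "y = proj p" by (rule proj.preimage)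
    then show "y \<in> proj.cod.span ?S" using subsetD[OF T] by simp
  qed
qed

lemma closure_fin_dim: "VG.fin_dim"
proof -
  let ?S = "(\<lambda>f. proj (mon f)) ` Idx"
  have "proj.cod.gen_set ?S" by (rule closure_generated[OF subset_refl mon_in_monspan])
  moreover have "?S \<subseteq> carrier G" using mon_closed proj.h_closed by blast
  ultimately show ?thesis unfolding VG.fin_dim_def using finite_Idx by blast
qed

lemma closure_dim_le:
  assumes "C \<subseteq> Idx" "\<And>f. f \<in> Idx \<Longrightarrow> mon f \<in> monspan C"
  shows "VG.dim \<le> card C"
proof -
  have fin: "finite C" using assms(1) finite_Idx finite_subset by blast
  have "VG.dim \<le> card ((\<lambda>f. proj (mon f)) ` C)"
  proof (rule VG.gen_ge_dim[OF _ _ closure_generated[OF assms]])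
    show "(\<lambda>f. proj (mon f)) ` C \<subseteq> carrier G" using assms(1) mon_closed proj.h_closed by blast
  qed (simp add: fin)
  also have "\<dots> \<le> card C" by (rule card_image_le[OF fin])
  finally show ?thesis .
qed

text \<open>Thin out the spanning set of all classes of monomials to a basis, and choose one monomial for each
of its elements.\<close>

lemma monomial_basis_exists:
  "\<exists>C\<subseteq>Idx. card C = VG.dim \<and> (\<forall>f\<in>Idx. mon f \<in> monspan C)"
proof -
  let ?S = "(\<lambda>f. proj (mon f)) ` Idx"
  have sub: "?S \<subseteq> carrier G" using mon_closed proj.h_closed by blast
  have "proj.cod.gen_set ?S" by (rule closure_generated[OF subset_refl mon_in_monspan])
  then have "\<exists>B\<subseteq>?S. minimal B (\<lambda>S. S \<subseteq> carrier G \<and> proj.cod.gen_set S)"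
    using minimal_exists[of ?S "\<lambda>S. S \<subseteq> carrier G \<and> proj.cod.gen_set S"] finite_Idx sub by simp
  then obtain B where B: "B \<subseteq> ?S" "minimal B (\<lambda>S. S \<subseteq> carrier G \<and> proj.cod.gen_set S)" by blast
  have basis: "VG.basis B" by (rule VG.min_gen_is_basis[OF B(2)])
  have finB: "finite B" using finite_Idx by (rule finite_surj[OF _ B(1)])
  obtain C where C: "C \<subseteq> Idx" "inj_on (\<lambda>f. proj (mon f)) C" "B = (\<lambda>f. proj (mon f)) ` C"
    using B(1) unfolding subset_image_inj by blast
  have "card C = VG.dim" using VG.dim_basis[OF finB basis] C by (simp add: card_image)
  moreover have "mon f \<in> monspan C" if f: "f \<in> Idx" for f
  proof -
    have BG: "B \<subseteq> carrier G" using B(1) sub by (rule order.trans)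
    have "proj (mon f) \<in> proj.cod.span B"
      using proj.h_closed[OF mon_closed[OF f]] basis unfolding VG.basis_def by simp
    then obtain a where a: "proj.cod.lincomb a B = proj (mon f)"
      using proj.cod.finite_in_span[OF finB BG] by blast
    define q where "q = (\<Sum>g\<in>C. scale (a (proj (mon g))) (mon g))"
    have summand: "scale c (mon g) \<in> carrier T" if "g \<in> C" for c g
      using mon_closed[of g] that C(1) by (auto intro!: keys_scale_subset)
    have qT: "q \<in> carrier T"
      unfolding q_def using summand by (simp add: keys_sum_subset)
    have "proj.cod.lincomb a B = (\<Oplus>\<^bsub>G\<^esub>g\<in>C. a (proj (mon g)) \<odot>\<^bsub>G\<^esub> proj (mon g))"
      unfolding proj.cod.lincomb_def C(3)
      using C(1,2) mon_closed proj.h_closed by (intro proj.cod.M.add.finprod_reindex) auto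
    also have "\<dots> = (\<Oplus>\<^bsub>G\<^esub>g\<in>C. proj (scale (a (proj (mon g))) (mon g)))"
    proof (rule proj.cod.M.finsum_cong')
      show "(\<lambda>g. proj (scale (a (proj (mon g))) (mon g))) \<in> C \<rightarrow> carrier G"
        using proj.h_closed[OF summand] by blast
      fix g assume "g \<in> C"
      then show "a (proj (mon g)) \<odot>\<^bsub>G\<^esub> proj (mon g) = proj (scale (a (proj (mon g))) (mon g))"
        using proj.h_smult[of "a (proj (mon g))", OF _ mon_closed] C(1) by auto
    qed simp
    also have "\<dots> = proj (\<Oplus>\<^bsub>T\<^esub>g\<in>C. scale (a (proj (mon g))) (mon g))"
    proof -
      have "(\<lambda>g. scale (a (proj (mon g))) (mon g)) \<in> C \<rightarrow> carrier T" using summand by blast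
      from proj.hom.hom_finsum[OF this] show ?thesis by (simp only: comp_def)
    qed
    also have "(\<Oplus>\<^bsub>T\<^esub>g\<in>C. scale (a (proj (mon g))) (mon g)) = q"
      unfolding q_def
      by (rule finsum_eq_sum) (use summand T.M.abelian_monoid_axioms in auto)
    finally have "proj (mon f) = proj q" unfolding a .
    then have "proj (mon f \<ominus>\<^bsub>T\<^esub> q) = \<zero>\<^bsub>G\<^esub>"
      using proj.h_minus[OF mon_closed[OF f] qT] proj.h_closed[OF qT] proj.cod.M.r_neg
      by (simp add: a_minus_def)
    moreover have "mon f \<ominus>\<^bsub>T\<^esub> q \<in> carrier T"
      by (rule T.M.minus_closed[OF mon_closed[OF f] qT])
    ultimately have "mon f - q \<in> J"
      unfolding T_minus[OF mon_closed[OF f] qT] by (simp only: proj_eq_zero_iff)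
    then have "eqmod (monspan C) (mon f) q"
      using J_subset_monspan by (auto simp: eqmod_def)
    moreover have "q \<in> monspan C"
      unfolding q_def
      by (intro pm.subspace_sum pm.subspace_scale subspace_monspan mon_in_monspan)
    ultimately show ?thesis by (rule eqmod_mem[OF subspace_monspan])
  qed
  ultimately show ?thesis using C(1) by blast
qed

end

text \<open>Since \<open>n \<ge> 1\<close>, the unit is nonzero and hence linearly independent, so it can be exchanged for an element of a basis.\<close>

lemma spanning_list_with_unit:
  fixes A :: "('k::field, 'a) module" (structure)
  assumes alg: "algebra class_ring A" and fd: "vectorspace.fin_dim class_ring A"
    and dim: "vectorspace.dim class_ring A = n" and n: "1 \<le> n"
  shows "\<exists>b coord. (\<forall>k<n. b k \<in> carrier A) \<and> b 0 = \<one> \<and>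
    (\<forall>a\<in>carrier A. a = (\<Oplus>k\<in>{..<n}. coord a k \<odot> b k))"
proof -
  interpret algebra "class_ring :: 'k ring" A by fact
  interpret V: vectorspace "class_ring :: 'k ring" A by (rule algebra_vectorspace[OF alg])
  have one_neq_zero: "\<one> \<noteq> \<zero>"
  proof
    assume "\<one> = \<zero>"
    then have "x = \<zero>" if "x \<in> carrier A" for x
      using that l_one[OF that] l_null[OF that] by simp
    then have zero: "carrier A = {\<zero>}" using M.zero_closed by blast
    have "span {} = carrier A" unfolding zero by (simp add: finite_span lincomb_def)
    then have "V.dim \<le> 0" using V.gen_ge_dim[of "{}"] by simp
    then show False using dim n by simp
  qed
  have li: "\<not> lin_dep {\<one>}"
  proof (rule finite_lin_indpt2)
    fix a assume "lincomb a {\<one>} = \<zero>"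
    then have zero: "a \<one> \<odot> \<one> = \<zero>" by (simp add: lincomb_def)
    show "\<forall>v\<in>{\<one>}. a v = \<zero>\<^bsub>class_ring\<^esub>"
    proof (rule ccontr)
      assume "\<not> ?thesis"
      then have "a \<one> \<noteq> 0" by simp
      then have "\<one> = inverse (a \<one>) \<odot> (a \<one> \<odot> \<one>)"
        using smult_assoc1[of "inverse (a \<one>)" "a \<one>" \<one>] smult_one[of \<one>] by simp
      then show False using zero one_neq_zero smult_r_null[of "inverse (a \<one>)"] by simp
    qed
  qed simp_all
  obtain \<beta> where \<beta>: "finite \<beta>" "V.basis \<beta>" using V.finite_basis_exists[OF fd] by blast
  have card: "card \<beta> = n" using V.dim_basis[OF \<beta>] dim by simp
  have \<beta>A: "\<beta> \<subseteq> carrier A" and gen: "span \<beta> = carrier A" using \<beta>(2) by (simp_all add: V.basis_def)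
  have "\<exists>C. finite C \<and> C \<subseteq> carrier A \<and> C \<subseteq> span \<beta> \<and> C \<inter> {\<one>} = {} \<and>
      int (card C) \<le> int (card \<beta>) - int (card {\<one>}) \<and> span ({\<one>} \<union> C) = span \<beta>"
  proof (rule V.replacement[OF _ \<beta>(1) \<beta>A li])
    show "{\<one>} \<subseteq> span \<beta>" unfolding gen by simp
  qed simp
  then obtain C where C: "finite C" "C \<subseteq> carrier A" "C \<inter> {\<one>} = {}"
    "int (card C) \<le> int (card \<beta>) - int (card {\<one>})" "span ({\<one>} \<union> C) = span \<beta>"
    by (elim exE conjE)
  obtain cs where cs: "set cs = C" "distinct cs" using finite_distinct_list[OF C(1)] by blast
  define bs where "bs = \<one> # cs"
  have dist: "distinct bs" using C(3) cs by (auto simp: bs_def)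
  have bsA: "set bs \<subseteq> carrier A" using C(2) cs by (auto simp: bs_def)
  have span_bs: "span (set bs) = carrier A" using C(5) cs gen by (simp add: bs_def)
  have len: "length bs = n"
  proof -
    have "card C = length cs" using cs distinct_card by blast
    then have "length bs \<le> n" using C(4) card n by (simp add: bs_def)
    moreover have "n \<le> length bs"
      using V.gen_ge_dim[OF _ bsA span_bs] dim distinct_card[OF dist] by simp
    ultimately show ?thesis by simp
  qed
  have "\<forall>a. \<exists>d. a \<in> carrier A \<longrightarrow> a = (\<Oplus>k\<in>{..<n}. d k \<odot> bs ! k)"
  proof
    fix a
    show "\<exists>d. a \<in> carrier A \<longrightarrow> a = (\<Oplus>k\<in>{..<n}. d k \<odot> bs ! k)"
    proof (cases "a \<in> carrier A")
      case True
      then obtain d where "a = (\<Oplus>k\<in>{..<length bs}. d k \<odot> bs ! k)"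
        using V.spanning_list[OF bsA span_bs dist True] by (elim exE conjE)
      then show ?thesis unfolding len by (intro exI[of _ d] impI)
    qed simp
  qed
  from choice[OF this] obtain coord
    where "\<forall>a. a \<in> carrier A \<longrightarrow> a = (\<Oplus>k\<in>{..<n}. coord a k \<odot> bs ! k)" by (rule exE)
  then have "\<forall>a\<in>carrier A. a = (\<Oplus>k\<in>{..<n}. coord a k \<odot> bs ! k)" by (rule Ball_def[THEN iffD2])
  moreover have "\<forall>k<n. bs ! k \<in> carrier A"
    using subsetD[OF bsA nth_mem] len by simp
  moreover have "bs ! 0 = \<one>" by (simp add: bs_def)
  ultimately show ?thesis by (intro exI[of _ "\<lambda>k. bs ! k"] exI[of _ coord] conjI)
qed

theorem theorem8:
  fixes A :: "('k::field, 'a) module" and n :: nat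
  assumes "n \<ge> 1"
    and "algebra class_ring A"
    and "vectorspace.fin_dim class_ring A"
    and "vectorspace.dim class_ring A = n"
  shows "vectorspace.fin_dim class_ring (Sn_closure A)
       \<and> vectorspace.fin_dim class_ring (Sn_closure (R_alg n :: ('k, _) module))
       \<and> vectorspace.dim class_ring (Sn_closure A)
           \<le> vectorspace.dim class_ring (Sn_closure (R_alg n :: ('k, _) module))"
proof -
  obtain b coord where b: "\<forall>k<n. b k \<in> carrier A" "b 0 = \<one>\<^bsub>A\<^esub>"
    and coord: "\<forall>a\<in>carrier A. a = (\<Oplus>\<^bsub>A\<^esub>k\<in>{..<n}. coord a k \<odot>\<^bsub>A\<^esub> b k)"
    using spanning_list_with_unit[OF assms(2,3,4,1)] by (elim exE conjE)
  interpret A: algebra "class_ring :: 'k ring" A by fact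
  interpret A: monomial_power A n b coord
  proof unfold_locales
    show "vectorspace.dim class_ring A = n" by fact
    show "0 < n" using assms(1) by simp
  qed (assumption | rule b b(1)[rule_format] bspec[OF coord])+
  interpret R: square_zero_algebra n "TYPE('k)"
    by unfold_locales (rule assms(1))
  interpret degeneration A n b coord R.R R.gen R.coord
    by unfold_locales
      (rule R.coord_add R.coord_smult R.coord_mult_join R.coord_gen R.char_coeff_R; assumption)+
  obtain C where C: "C \<subseteq> R.RP.Idx" "card C = R.RP.VG.dim"
    "\<forall>f\<in>R.RP.Idx. R.RP.mon f \<in> R.RP.monspan C"
    using R.RP.monomial_basis_exists by (elim exE conjE)
  have "A.VG.dim \<le> card C"
    by (rule A.closure_dim_le[OF C(1) monspan_transfer[OF C(1) bspec[OF C(3)]]])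
  then show ?thesis using A.closure_fin_dim R.RP.closure_fin_dim unfolding C(2) by (intro conjI)
qed

end
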